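(* Under Assumption 1 (stated in the context), let $\bm{x}=(\bm{x}_1,\dots,\bm{x}_n)$ be the output of Algorithm 1 (stated in the context) and let $\hat{R}_n^{SOCP}$ be the optimal objective value of the SOCP problem (stated in the context). Then the expected optimality gap and the expected constraint violation of Algorithm 1 compared to the optimal solution of the SOCP problem are on the order of $\sqrt{n}$, i.e. $$-O(\sqrt{n}) \le \mathbb{E}\left[\hat{R}_n^{SOCP}-\sum_{t=1}^n \bm{c}_t^\top \bm{x}_t\right] \le O(\sqrt{n}),$$ $$\mathbb{E}\left[\left\|\left(\bm{g}(\bm{x})-\bm{b}\right)^+\right\|_2\right] \le O(\sqrt{n}),$$ where $\bm{g}(\bm{x})=(g_1(\bm x),\dots,g_m(\bm x))^\top$ with $g_j(\bm{x})=\sum_{t=1}^n \bar{\bm{a}}_{tj}^\top\bm{x}_t+\psi_j\sqrt{\sum_{t=1}^n\bm{x}_t^\top\bm{K}_{tj}\bm{x}_t}$ is the left-hand side of the second-order cone constraints.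
   Context: Setting. $n$ (requests), $m$ (resources), $k$ (schemes per request) are positive integers; $m,k$ are fixed while $n$ varies. For $t=1,\dots,n$ and $j=1,\dots,m$: $\bm{c}_t\in\mathbb{R}^k$, $\bar{\bm{a}}_{tj}\in\mathbb{R}^k$, $\bm{K}_{tj}\in\mathbb{R}^{k\times k}$ is a covariance matrix (symmetric positive semidefinite), and $\bm{b}=(b_1,\dots,b_m)^\top\in\mathbb{R}^m$. The numbers $\psi_1,\dots,\psi_m>0$ are fixed constants (in the paper $\psi_j=\max\{\Phi^{-1}(\eta_j),h^{-1}(\tilde\gamma_j)\}$ for given levels $\eta_j,\tilde\gamma_j$, where $\Phi$ is the standard Gaussian CDF and $h(z)=\frac{e^{-z^2/2}/\sqrt{2\pi}}{1-\Phi(z)}-z$). $\bm{\gamma}_{tj}\in\mathbb{R}^k$ is the vector of square roots of the diagonal entries of $\bm{K}_{tj}$. Put $\tilde{\bm{a}}_{tj}=\bar{\bm{a}}_{tj}+\frac{\psi_j}{\sqrt{n}}\bm{\gamma}_{tj}$, and let $\tilde{\bm{A}}_t\in\mathbb{R}^{m\times k}$ be the matrix with rows $\tilde{\bm{a}}_{t1}^\top,\dots,\tilde{\bm{a}}_{tm}^\top$. Assumption 1. (a) The coefficient tuples $\xi_t=(\bm{c}_t,(\bar{\bm{a}}_{tj})_{j},(\bm{K}_{tj})_{j})$, $t=1,\dots,n$, are sampled i.i.d. from an unknown distribution $\mathcal{P}$. (b) The coefficients are bounded (by constants not depending on $n$). (c) $\bm{b}=n\bm{d}$, where $\bm{d}$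 is bounded with positive upper and lower bounds: $0<\underline{d}\le d_j\le\bar{d}$ for all $j$, with $\underline{d},\bar d$ not depending on $n$. SOCP problem: maximize $\sum_{t=1}^n\bm{c}_t^\top\bm{x}_t$ subject to $\sum_{t=1}^n\bar{\bm{a}}_{tj}^\top\bm{x}_t+\psi_j\sqrt{\sum_{t=1}^n\bm{x}_t^\top\bm{K}_{tj}\bm{x}_t}\le b_j$ for all $j=1,\dots,m$, and $\bm{1}^\top\bm{x}_t\le1$, $\bm{x}_t\ge\bm{0}$ for all $t=1,\dots,n$ ($\bm{x}_t\in\mathbb{R}^k$). Algorithm 1. Initialize $\bm{p}_1=\bm{0}\in\mathbb{R}^m$. For $t=1,\dots,n$: set $v_t=\max_{l=1,\dots,k}(\bm{c}_t^\top-\bm{p}_t^\top\tilde{\bm{A}}_t)\bm{e}_l$, where $\bm{e}_l$ is the $l$-th unit vector of $\mathbb{R}^k$. If $v_t>0$, pick an index $l_t$ randomly from $\{l: v_t=(\bm{c}_t^\top-\bm{p}_t^\top\tilde{\bm{A}}_t)\bm{e}_l\}$ and set $\bm{x}_t=\bm{e}_{l_t}$; otherwise set $\bm{x}_t=\bm{0}$. Then set $\bm{p}_{t+1}=\max\{\bm{p}_t+\frac{1}{\sqrt{n}}(\tilde{\bm{A}}_t\bm{x}_t-\bm{d}),\bm{0}\}$ (componentwise maximum). Output $(\bm{x}_1,\dots,\bm{x}_n)$. Conventions. $\mathbb{E}$ is expectation over the i.i.d. coefficients drawn from $\mathcal{P}$ (and the random tie-breaking of the algorithm). $(\cdot)^+$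 is the componentwise positive part. $O(\sqrt{n})$ denotes a quantity bounded by $C\sqrt{n}$ with a constant $C\ge 0$ not depending on $n$; "$\ge -O(\sqrt n)$" means $\ge -C\sqrt n$ for such a $C$. *)

theory Defs
  imports "HOL-Probability.Probability"
begin

text \<open>
  A request is a tuple \<open>(c, a, K)\<close>: the reward vector \<open>c\<close>, the matrix \<open>a\<close> whose row \<open>a $ j\<close> is
  the mean consumption of resource \<open>j\<close>, and the family \<open>K $ j\<close> of its covariance matrices.
  The index types \<open>'m\<close> and \<open>'k\<close> stand for the resources and for the schemes per request.
\<close>

type_synonym ('m, 'k) request = "(real^'k) \<times> (real^'k^'m) \<times> (real^'k^'k^'m)"

definition reward :: "('m::finite, 'k::finite) request \<Rightarrow> real^'k" where
  "reward z = fst z"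

definition mean_use :: "('m::finite, 'k::finite) request \<Rightarrow> real^'k^'m" where
  "mean_use z = fst (snd z)"

definition cov_use :: "('m::finite, 'k::finite) request \<Rightarrow> real^'k^'k^'m" where
  "cov_use z = snd (snd z)"

definition covariance_matrix :: "real^'k^'k \<Rightarrow> bool" where
  "covariance_matrix K \<longleftrightarrow> transpose K = K \<and> (\<forall>x. 0 \<le> x \<bullet> (K *v x))"

definition bounded_request :: "real \<Rightarrow> ('m::finite, 'k::finite) request \<Rightarrow> bool" where
  "bounded_request B z \<longleftrightarrow> norm (reward z) \<le> B \<and>
     (\<forall>j. norm (mean_use z $ j) \<le> B \<and> norm (cov_use z $ j) \<le> B)"

definition pos_part :: "real^'m \<Rightarrow> real^'m" where
  "pos_part u = (\<chi> j. max (u $ j) 0)"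

text \<open>Requests and decisions are sequences of which only the entries \<open>1, \<dots>, n\<close> matter.\<close>

definition objective ::
  "nat \<Rightarrow> (nat \<Rightarrow> ('m::finite, 'k::finite) request) \<Rightarrow> (nat \<Rightarrow> real^'k) \<Rightarrow> real" where
  "objective n \<xi> x = (\<Sum>t=1..n. reward (\<xi> t) \<bullet> x t)"

definition cone_lhs ::
  "nat \<Rightarrow> real^'m \<Rightarrow> (nat \<Rightarrow> ('m::finite, 'k::finite) request) \<Rightarrow> (nat \<Rightarrow> real^'k) \<Rightarrow> real^'m" where
  "cone_lhs n \<psi> \<xi> x = (\<chi> j.
     (\<Sum>t=1..n. mean_use (\<xi> t) $ j \<bullet> x t) +
     \<psi> $ j * sqrt (\<Sum>t=1..n. x t \<bullet> (cov_use (\<xi> t) $ j *v x t)))"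

definition socp_feasible ::
  "nat \<Rightarrow> real^'m \<Rightarrow> real^'m \<Rightarrow> (nat \<Rightarrow> ('m::finite, 'k::finite) request) \<Rightarrow> (nat \<Rightarrow> real^'k) set" where
  "socp_feasible n \<psi> b \<xi> = {x.
     (\<forall>j. cone_lhs n \<psi> \<xi> x $ j \<le> b $ j) \<and>
     (\<forall>t\<in>{1..n}. (\<Sum>l\<in>UNIV. x t $ l) \<le> 1 \<and> (\<forall>l. 0 \<le> x t $ l))}"

definition socp_value ::
  "nat \<Rightarrow> real^'m \<Rightarrow> real^'m \<Rightarrow> (nat \<Rightarrow> ('m::finite, 'k::finite) request) \<Rightarrow> real" where
  "socp_value n \<psi> b \<xi> = (SUP x\<in>socp_feasible n \<psi> b \<xi>. objective n \<xi> x)"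

definition adjusted_use ::
  "nat \<Rightarrow> real^'m \<Rightarrow> ('m::finite, 'k::finite) request \<Rightarrow> real^'k^'m" where
  "adjusted_use n \<psi> z = (\<chi> j. mean_use z $ j +
     (\<psi> $ j / sqrt (real n)) *\<^sub>R (\<chi> l. sqrt (cov_use z $ j $ l $ l)))"

definition reduced_reward ::
  "nat \<Rightarrow> real^'m \<Rightarrow> ('m::finite, 'k::finite) request \<Rightarrow> real^'m \<Rightarrow> real^'k" where
  "reduced_reward n \<psi> z p = reward z - p v* adjusted_use n \<psi> z"

text \<open>
  The distribution used for breaking ties is a parameter: \<open>tie S\<close> is the law of the index picked
  from the set \<open>S\<close> of maximizers, e.g. \<open>tie = pmf_of_set\<close> for a uniform choice.
\<close>

definition tie_breaking :: "('k set \<Rightarrow> 'k pmf) \<Rightarrow> bool" where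
  "tie_breaking tie \<longleftrightarrow> (\<forall>S. S \<noteq> {} \<longrightarrow> set_pmf (tie S) \<subseteq> S)"

definition decision ::
  "nat \<Rightarrow> real^'m \<Rightarrow> ('k set \<Rightarrow> 'k pmf) \<Rightarrow> ('m::finite, 'k::finite) request \<Rightarrow> real^'m \<Rightarrow> (real^'k) pmf"
where
  "decision n \<psi> tie z p =
     (let r = reduced_reward n \<psi> z p; v = Max (range (\<lambda>l. r $ l))
      in if v > 0 then map_pmf (\<lambda>l. axis l 1) (tie {l. v = r $ l}) else return_pmf 0)"

definition price_update ::
  "nat \<Rightarrow> real^'m \<Rightarrow> real^'m \<Rightarrow> ('m::finite, 'k::finite) request \<Rightarrow> real^'m \<Rightarrow> real^'k \<Rightarrow> real^'m" where
  "price_update n \<psi> d z p y =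
     pos_part (p + (1 / sqrt (real n)) *\<^sub>R (adjusted_use n \<psi> z *v y - d))"

text \<open>
  For fixed requests \<open>\<xi>\<close>, the joint law of the decisions \<open>x 1, \<dots>, x t\<close> and of the next price
  vector \<open>p (t + 1)\<close> after \<open>t\<close> rounds; the randomness is that of the tie-breaking only.
\<close>

primrec run ::
  "nat \<Rightarrow> real^'m \<Rightarrow> real^'m \<Rightarrow> ('k set \<Rightarrow> 'k pmf) \<Rightarrow> (nat \<Rightarrow> ('m::finite, 'k::finite) request) \<Rightarrow>
   nat \<Rightarrow> ((nat \<Rightarrow> real^'k) \<times> (real^'m)) pmf"
where
  "run n \<psi> d tie \<xi> 0 = return_pmf (\<lambda>_. 0, 0)"
| "run n \<psi> d tie \<xi> (Suc t) =
     bind_pmf (run n \<psi> d tie \<xi> t) (\<lambda>(x, p).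
       map_pmf (\<lambda>y. (x(Suc t := y), price_update n \<psi> d (\<xi> (Suc t)) p y))
         (decision n \<psi> tie (\<xi> (Suc t)) p))"

definition algorithm_output ::
  "nat \<Rightarrow> real^'m \<Rightarrow> real^'m \<Rightarrow> ('k set \<Rightarrow> 'k pmf) \<Rightarrow> (nat \<Rightarrow> ('m::finite, 'k::finite) request) \<Rightarrow>
   (nat \<Rightarrow> real^'k) pmf"
where
  "algorithm_output n \<psi> d tie \<xi> = map_pmf fst (run n \<psi> d tie \<xi> n)"

definition iid_requests ::
  "('m::finite, 'k::finite) request measure \<Rightarrow> nat \<Rightarrow> (nat \<Rightarrow> ('m, 'k) request) measure" where
  "iid_requests P n = (\<Pi>\<^sub>M t\<in>{1..n}. P)"

text \<open>
  Mean over the tie-breaking for fixed requests. Expectations over both sources of randomness are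
  integrals of these means with respect to \<open>iid_requests P n\<close>.
\<close>

definition mean_gap ::
  "nat \<Rightarrow> real^'m \<Rightarrow> real^'m \<Rightarrow> ('k set \<Rightarrow> 'k pmf) \<Rightarrow> (nat \<Rightarrow> ('m::finite, 'k::finite) request) \<Rightarrow> real"
where
  "mean_gap n \<psi> d tie \<xi> = measure_pmf.expectation (algorithm_output n \<psi> d tie \<xi>)
     (\<lambda>x. socp_value n \<psi> (real n *\<^sub>R d) \<xi> - objective n \<xi> x)"

definition mean_violation ::
  "nat \<Rightarrow> real^'m \<Rightarrow> real^'m \<Rightarrow> ('k set \<Rightarrow> 'k pmf) \<Rightarrow> (nat \<Rightarrow> ('m::finite, 'k::finite) request) \<Rightarrow> real"
where
  "mean_violation n \<psi> d tie \<xi> = measure_pmf.expectation (algorithm_output n \<psi> d tie \<xi>)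
     (\<lambda>x. norm (pos_part (cone_lhs n \<psi> \<xi> x - real n *\<^sub>R d)))"

end

theory Submission imports Defs
begin

text \<open>
  The algorithm is projected subgradient descent on the dual with step size \<open>1 / sqrt n\<close>.
  While the price exceeds a constant, a purchase costs at most its reward but the budget \<open>d\<close>
  is earned in every round, so the price shrinks; hence prices stay bounded, and since they
  accumulate the overuse of the resources, the violation is \<open>O (sqrt n)\<close>. Here decisions are
  unit vectors or zero, so the cone term of the output is \<open>O (sqrt n)\<close> too. Shrinking the output
  by a factor \<open>1 - O (1 / sqrt n)\<close> makes it feasible, which bounds the gap from below.

  For the upper bound, the squared price is a potential whose telescoping sum compares the reward
  of the algorithm with \<open>\<Sum>t. D (\<xi> (t + 1), p t)\<close>, where \<open>D (z, p)\<close> is the Lagrangian dual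
  function of a single request. Request \<open>t + 1\<close> is independent of the price after \<open>t\<close> rounds,
  and by weak duality the mean of \<open>D (z, p)\<close> at any bounded price \<open>p \<ge> 0\<close> is at least
  \<open>1 / n\<close> times the expected optimal value, up to \<open>O (1 / sqrt n)\<close>. Measurability of
  the optimal value holds because it is upper semicontinuous in the requests.
\<close>

section \<open>Boundedness of the prices\<close>

text \<open>Collects the almost sure assumptions on a single request, so that everything before the
  integration over the requests can be argued pointwise.\<close>

definition admissible :: "real \<Rightarrow> ('m::finite, 'k::finite) request \<Rightarrow> bool" where
  "admissible B z \<longleftrightarrow> bounded_request B z \<and> (\<forall>j. covariance_matrix (cov_use z $ j))"

text \<open>The values a decision of the algorithm can take; they are the vertices of
  \<open>subsimplex\<close>.\<close>

definition choices :: "(real^'k) set" where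
  "choices = insert 0 (range (\<lambda>l. axis l 1))"

text \<open>The support function of \<open>subsimplex\<close> at the reduced reward; the outer
  \<open>max 0\<close> accounts for rejecting the request.\<close>

definition best_reward ::
  "nat \<Rightarrow> real^'m \<Rightarrow> ('m::finite, 'k::finite) request \<Rightarrow> real^'m \<Rightarrow> real" where
  "best_reward n \<psi> z p = max 0 (Max (range (\<lambda>l. reduced_reward n \<psi> z p $ l)))"

text \<open>This is \<open>D (z, p)\<close>: the maximum over decisions \<open>y\<close> of
  \<open>reward z \<bullet> y - p \<bullet> (adjusted_use n \<psi> z *v y -
  \<delta>)\<close>.\<close>

definition dual_term ::
  "nat \<Rightarrow> real^'m \<Rightarrow> real^'m \<Rightarrow> ('m::finite, 'k::finite) request \<Rightarrow> real^'m \<Rightarrow> real" where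
  "dual_term n \<psi> \<delta> z p = p \<bullet> \<delta> + best_reward n \<psi> z p"

section \<open>Entrywise bounds for a request, and the properties of one decision\<close>

lemma norm_pos_part_le: "norm (pos_part u) \<le> norm u"
  by (rule norm_le_componentwise_cart) (auto simp: pos_part_def max_def)

lemma pos_part_nonneg: "0 \<le> pos_part u $ j"
  by (simp add: pos_part_def)

lemma le_pos_part: "u $ j \<le> pos_part u $ j"
  by (simp add: pos_part_def)

lemma inner_matrix_axis: "axis l 1 \<bullet> ((K :: real^'k^'k) *v axis l 1) = K $ l $ l"
  by (simp add: matrix_vector_mult_basis column_def inner_axis')

lemma covariance_matrix_diag_nonneg: "covariance_matrix K \<Longrightarrow> 0 \<le> K $ l $ l"
  unfolding covariance_matrix_def by (metis inner_matrix_axis)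

lemma abs_entry_le_norm: "\<bar>(K :: real^'k^'l) $ i $ l\<bar> \<le> norm K"
  by (metis Finite_Cartesian_Product.norm_nth_le component_le_norm_cart order_trans)

lemma admissible_nonneg: "admissible B z \<Longrightarrow> 0 \<le> B"
  unfolding admissible_def bounded_request_def by (meson norm_ge_zero order_trans)

lemma admissible_reward: "admissible B z \<Longrightarrow> norm (reward z) \<le> B"
  by (simp add: admissible_def bounded_request_def)

lemma admissible_mean_use: "admissible B z \<Longrightarrow> \<bar>mean_use z $ j $ l\<bar> \<le> B"
  unfolding admissible_def bounded_request_def
  by (meson component_le_norm_cart order_trans)

lemma admissible_cov_diag:
  assumes "admissible B z" shows "0 \<le> cov_use z $ j $ l $ l" "cov_use z $ j $ l $ l \<le> B"
proof -
  show "0 \<le> cov_use z $ j $ l $ l"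
    using assms covariance_matrix_diag_nonneg by (auto simp: admissible_def)
  have "norm (cov_use z $ j) \<le> B" using assms by (simp add: admissible_def bounded_request_def)
  thus "cov_use z $ j $ l $ l \<le> B" using abs_entry_le_norm[of "cov_use z $ j" l l] by linarith
qed

lemma matrix_vector_axis: "(A *v axis l 1) $ j = (A :: real^'k^'m) $ j $ l"
  by (simp add: matrix_vector_mult_basis column_def)

lemma reduced_reward_inner:
  "reduced_reward n \<psi> z p \<bullet> y = reward z \<bullet> y - p \<bullet> (adjusted_use n \<psi> z *v y)"
  by (simp add: reduced_reward_def inner_diff_left dot_lmul_matrix)

lemma adjusted_use_nth:
  "adjusted_use n \<psi> z $ j $ l =
     mean_use z $ j $ l + \<psi> $ j / sqrt (real n) * sqrt (cov_use z $ j $ l $ l)"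
  by (simp add: adjusted_use_def)

lemma choices_cases:
  assumes "y \<in> choices" obtains "y = 0" | l where "y = axis l 1"
  using assms by (auto simp: choices_def)

lemma norm_choices: "y \<in> choices \<Longrightarrow> norm y \<le> 1"
  by (auto simp: choices_def norm_axis_1)

text \<open>Ties are broken inside the set of maximizers, so every decision of positive probability
  is optimal for the reduced reward; rejection happens exactly when no coordinate is positive, where
  the optimum is 0.\<close>

lemma set_pmf_decision:
  fixes p :: "real^'m" and z :: "('m::finite, 'k::finite) request"
  assumes "tie_breaking tie" "y \<in> set_pmf (decision n \<psi> tie z p)"
  shows "y \<in> choices" "reduced_reward n \<psi> z p \<bullet> y = best_reward n \<psi> z p"
proof -
  define r where "r = reduced_reward n \<psi> z p"
  define v where "v = Max (range (\<lambda>l. r $ l))"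
  have "v \<in> range (\<lambda>l. r $ l)" unfolding v_def by (rule Max_in) auto
  hence "{l. v = r $ l} \<noteq> {}" by auto
  hence tie: "set_pmf (tie {l. v = r $ l}) \<subseteq> {l. v = r $ l}"
    using assms(1) by (simp add: tie_breaking_def)
  have "(\<exists>l. y = axis l 1 \<and> v = r $ l \<and> v > 0) \<or> (y = 0 \<and> v \<le> 0)"
    using assms(2) tie
    by (auto simp: decision_def Let_def r_def[symmetric] v_def[symmetric] split: if_splits)
  thus "y \<in> choices" "reduced_reward n \<psi> z p \<bullet> y = best_reward n \<psi> z p"
    by (auto simp: choices_def best_reward_def r_def[symmetric] v_def[symmetric] inner_axis)
qed

lemma finite_decision: "finite (set_pmf (decision n \<psi> tie z p :: (real^'k) pmf))"
  unfolding decision_def Let_def by auto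

lemma finite_run: "finite (set_pmf (run n \<psi> \<delta> tie \<xi> t))"
  by (induction t) (auto simp: finite_decision)

section \<open>Constants independent of \<open>n\<close>, and the drift of the price\<close>

text \<open>Each summand bounds one coordinate of the subgradient
  \<open>adjusted_use n \<psi> z *v y - \<delta>\<close>, so the sum bounds its Euclidean norm
  through the l1 norm.\<close>

definition step_bound :: "real \<Rightarrow> real^'m \<Rightarrow> real \<Rightarrow> real" where
  "step_bound B \<psi> du = (\<Sum>j\<in>UNIV. B + \<psi> $ j * sqrt B + du)"

text \<open>The first summand is the threshold above which the norm of the price cannot grow; the
  second is the overshoot of one step taken from below it.\<close>

definition price_bound :: "real \<Rightarrow> real^'m \<Rightarrow> real \<Rightarrow> real \<Rightarrow> real" where
  "price_bound B \<psi> dl du = (B + (step_bound B \<psi> du)\<^sup>2 / 2) / dl + step_bound B \<psi> du"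

text \<open>The horizon \<open>n\<close> is fixed here, and \<open>\<delta>\<close> is the budget
  per round at that horizon. Only \<open>B\<close>, \<open>\<psi>\<close>, \<open>dl\<close> and
  \<open>du\<close> enter the constants \<open>M\<close>, \<open>G\<close>, \<open>V\<close> and
  \<open>S\<close>, which makes these uniform in \<open>n\<close>.\<close>

locale online_socp =
  fixes n :: nat and \<psi> \<delta> :: "real^'m::finite" and tie :: "'k::finite set \<Rightarrow> 'k pmf"
    and B dl du :: real
  assumes n_ge_1: "1 \<le> n"
    and psi_pos: "\<And>j. 0 < \<psi> $ j"
    and dl_pos: "0 < dl"
    and delta_lower: "\<And>j. dl \<le> \<delta> $ j"
    and delta_upper: "\<And>j. \<delta> $ j \<le> du"
    and tie: "tie_breaking tie"
    and B_nonneg: "0 \<le> B"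
begin

abbreviation "M \<equiv> step_bound B \<psi> du"
abbreviation "G \<equiv> price_bound B \<psi> dl du"

lemma sqrt_n: "1 \<le> sqrt (real n)" "0 < real n" "sqrt (real n) * sqrt (real n) = real n"
  using n_ge_1 by auto

lemma delta_pos: "0 < \<delta> $ j"
  using dl_pos delta_lower[of j] by linarith

lemma du_nonneg: "0 \<le> du"
  using delta_pos delta_upper by (meson less_imp_le order_trans)

lemma divide_sqrt_n_le: "0 \<le> x \<Longrightarrow> x / sqrt (real n) \<le> x"
  using divide_left_mono[of 1 "sqrt (real n)" x] sqrt_n(1) by simp

lemma M_nonneg: "0 \<le> M"
  unfolding step_bound_def
  using B_nonneg psi_pos du_nonneg
  by (intro sum_nonneg add_nonneg_nonneg mult_nonneg_nonneg) (auto intro: less_imp_le)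

lemma M_le_G: "M \<le> G"
  unfolding price_bound_def using B_nonneg dl_pos by simp

lemma psi_scaled: "\<psi> $ j / sqrt (real n) \<le> \<psi> $ j" "0 \<le> \<psi> $ j / sqrt (real n)"
  using divide_sqrt_n_le psi_pos[of j] by (auto simp: less_imp_le)

lemma abs_adjusted_use:
  assumes "admissible B z" shows "\<bar>adjusted_use n \<psi> z $ j $ l\<bar> \<le> B + \<psi> $ j * sqrt B"
proof -
  have "\<psi> $ j / sqrt (real n) * sqrt (cov_use z $ j $ l $ l) \<le> \<psi> $ j * sqrt B"
    using psi_scaled[of j] admissible_cov_diag[OF assms, of j l] psi_pos[of j]
    by (intro mult_mono) auto
  moreover have "0 \<le> \<psi> $ j / sqrt (real n) * sqrt (cov_use z $ j $ l $ l)"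
    using psi_scaled[of j] admissible_cov_diag[OF assms, of j l] by (intro mult_nonneg_nonneg) auto
  ultimately show ?thesis
    using admissible_mean_use[OF assms, of j l] unfolding adjusted_use_nth by linarith
qed

lemma norm_step:
  assumes "admissible B z" "y \<in> choices"
  shows "norm (adjusted_use n \<psi> z *v y - \<delta>) \<le> M"
proof -
  have *: "\<bar>(adjusted_use n \<psi> z *v y - \<delta>) $ j\<bar> \<le> B + \<psi> $ j * sqrt B + du" for j
  proof -
    have "0 \<le> \<psi> $ j * sqrt B" using psi_pos[of j] B_nonneg by simp
    \<comment> \<open>The value \<open>a\<close> is the consumption of resource \<open>j\<close> by
      one decision: 0 for a rejection, a matrix entry for a unit vector. It is instantiated with
      both below.\<close>
    have "\<bar>a - \<delta> $ j\<bar> \<le> B + \<psi> $ j * sqrt B + du" if "\<bar>a\<bar> \<le> B + \<psi> $ j * sqrt B" for a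
      using that delta_pos[of j] delta_upper[of j] by linarith
    from this[of 0] this[of "adjusted_use n \<psi> z $ j $ l" for l] show ?thesis
      using assms(2) abs_adjusted_use[OF assms(1), of j] B_nonneg \<open>0 \<le> \<psi> $ j * sqrt B\<close>
      by (elim choices_cases) (simp_all add: matrix_vector_axis)
  qed
  show ?thesis
    unfolding step_bound_def by (rule order_trans[OF norm_le_l1_cart]) (intro sum_mono *)
qed

text \<open>The positive part does not increase the norm, so it suffices to treat the unprojected
  step: by the triangle inequality for the first claim, by expanding the square for the
  second.\<close>

lemma norm_price_update:
  assumes "admissible B z" "y \<in> choices"
  shows "norm (price_update n \<psi> \<delta> z p y) \<le> norm p + M / sqrt (real n)"
    "(norm (price_update n \<psi> \<delta> z p y))\<^sup>2 \<le>
       (norm p)\<^sup>2 + 2 / sqrt (real n) * (p \<bullet> (adjusted_use n \<psi> z *v y - \<delta>)) + M\<^sup>2 / real n"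
proof -
  define g where "g = adjusted_use n \<psi> z *v y - \<delta>"
  have g: "norm g \<le> M" unfolding g_def by (rule norm_step[OF assms])
  have le: "norm (price_update n \<psi> \<delta> z p y) \<le> norm (p + (1 / sqrt (real n)) *\<^sub>R g)"
    unfolding price_update_def g_def by (rule norm_pos_part_le)
  show "norm (price_update n \<psi> \<delta> z p y) \<le> norm p + M / sqrt (real n)"
    using le norm_triangle_ineq[of p "(1 / sqrt (real n)) *\<^sub>R g"]
      divide_right_mono[OF g, of "sqrt (real n)"] by simp
  have "(norm (price_update n \<psi> \<delta> z p y))\<^sup>2 \<le> (norm (p + (1 / sqrt (real n)) *\<^sub>R g))\<^sup>2"
    using le by (rule power_mono) simp
  also have "\<dots> = (norm p)\<^sup>2 + 2 / sqrt (real n) * (p \<bullet> g) + (norm g)\<^sup>2 / real n"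
    using sqrt_n
    by (simp add: power2_norm_eq_inner inner_add_left inner_add_right inner_commute field_simps)
  also have "\<dots> \<le> (norm p)\<^sup>2 + 2 / sqrt (real n) * (p \<bullet> g) + M\<^sup>2 / real n"
    using g by (intro add_mono order_refl divide_right_mono power_mono) auto
  finally show "(norm (price_update n \<psi> \<delta> z p y))\<^sup>2 \<le>
       (norm p)\<^sup>2 + 2 / sqrt (real n) * (p \<bullet> (adjusted_use n \<psi> z *v y - \<delta>)) + M\<^sup>2 / real n"
    unfolding g_def .
qed

lemma reward_choices:
  assumes "admissible B z" "y \<in> choices" shows "\<bar>reward z \<bullet> y\<bar> \<le> B"
proof -
  have "\<bar>reward z \<bullet> y\<bar> \<le> norm (reward z) * norm y" by (rule Cauchy_Schwarz_ineq2)
  also have "\<dots> \<le> B * 1"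
    using admissible_reward[OF assms(1)] norm_choices[OF assms(2)] B_nonneg
    by (intro mult_mono) auto
  finally show ?thesis by simp
qed

text \<open>Below the threshold one step adds at most \<open>M\<close>. Above it, an accepted
  request costs at most \<open>B\<close> while \<open>p \<bullet> \<delta>\<close> is at least
  \<open>dl * norm p\<close>, so the drift is at most \<open>- M^2 / 2\<close> and the norm does not
  increase.\<close>

lemma price_update_bounded:
  assumes z: "admissible B z" and p: "\<And>j. 0 \<le> p $ j" "norm p \<le> G"
    and y: "y \<in> set_pmf (decision n \<psi> tie z p)"
  shows "norm (price_update n \<psi> \<delta> z p y) \<le> G"
proof (cases "norm p \<le> (B + M\<^sup>2 / 2) / dl")
  case True
  have "M / sqrt (real n) \<le> M" 
    using M_nonneg by (rule divide_sqrt_n_le)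
  thus ?thesis
    using norm_price_update(1)[OF z set_pmf_decision(1)[OF tie y], of p] True
    unfolding price_bound_def by linarith
next
  case False
  have "0 \<le> reduced_reward n \<psi> z p \<bullet> y"
    by (simp add: set_pmf_decision(2)[OF tie y] best_reward_def)
  hence "p \<bullet> (adjusted_use n \<psi> z *v y) \<le> B"
    using reward_choices[OF z set_pmf_decision(1)[OF tie y]] by (simp add: reduced_reward_inner)
  moreover have "dl * norm p \<le> p \<bullet> \<delta>"
  proof -
    have "dl * norm p \<le> dl * (\<Sum>j\<in>UNIV. \<bar>p $ j\<bar>)"
      using dl_pos norm_le_l1_cart[of p] by (intro mult_left_mono) auto
    also have "\<dots> \<le> (\<Sum>j\<in>UNIV. p $ j * \<delta> $ j)"
      unfolding sum_distrib_left using p(1) delta_lower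
      by (intro sum_mono) (simp add: mult.commute[of "p $ _"] mult_right_mono)
    finally show ?thesis by (simp add: inner_vec_def)
  qed
  moreover have "B + M\<^sup>2 / 2 \<le> dl * norm p" using False dl_pos by (simp add: field_simps)
  ultimately have "p \<bullet> (adjusted_use n \<psi> z *v y - \<delta>) \<le> - (M\<^sup>2 / 2)"
    by (simp add: inner_diff_right)
  hence "2 / sqrt (real n) * (p \<bullet> (adjusted_use n \<psi> z *v y - \<delta>)) \<le>
      2 / sqrt (real n) * (- (M\<^sup>2 / 2))"
    by (rule mult_left_mono) simp
  \<comment> \<open>The drift contributes at most \<open>- M^2 / sqrt n\<close> to the squared norm.
    It absorbs the second-order term once that is weakened from \<open>M^2 / n\<close> to
    \<open>M^2 / sqrt n\<close>.\<close>
  moreover have "M\<^sup>2 / real n \<le> M\<^sup>2 / sqrt (real n)"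
  proof (rule divide_left_mono)
    show "sqrt (real n) \<le> real n" using sqrt_n using mult_left_mono[OF sqrt_n(1), of "sqrt (real n)"] by simp
  qed (use sqrt_n in auto)
  ultimately have "(norm (price_update n \<psi> \<delta> z p y))\<^sup>2 \<le> (norm p)\<^sup>2"
    using norm_price_update(2)[OF z set_pmf_decision(1)[OF tie y], of p] by (simp only: times_divide_eq_left times_divide_eq_right)
  hence "norm (price_update n \<psi> \<delta> z p y) \<le> norm p" by (rule power2_le_imp_le) simp
  thus ?thesis using p(2) by linarith
qed

lemma G_nonneg: "0 \<le> G"
  using M_le_G M_nonneg by linarith

text \<open>Taking positive parts only raises the price, so \<open>sqrt n\<close> times the price
  dominates the accumulated overuse of each resource. The decisions of rounds not yet played are 0,
  so the first conjunct can range over all \<open>s\<close>.\<close>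

lemma run_invariant:
  assumes "\<And>s. s \<in> {1..t} \<Longrightarrow> admissible B (\<xi> s)"
    and "(x, p) \<in> set_pmf (run n \<psi> \<delta> tie \<xi> t)"
  shows "(\<forall>s. x s \<in> choices) \<and> (\<forall>j. 0 \<le> p $ j) \<and> norm p \<le> G \<and>
    (\<forall>j. (\<Sum>s=1..t. (adjusted_use n \<psi> (\<xi> s) *v x s) $ j) - real t * \<delta> $ j \<le> sqrt (real n) * p $ j)"
  using assms
proof (induction t arbitrary: x p)
  case 0
  then show ?case using G_nonneg by (simp add: choices_def)
next
  case (Suc t)
  from Suc.prems(2) obtain x' p' y where *: "(x', p') \<in> set_pmf (run n \<psi> \<delta> tie \<xi> t)"
    "y \<in> set_pmf (decision n \<psi> tie (\<xi> (Suc t)) p')" "x = x'(Suc t := y)"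
    "p = price_update n \<psi> \<delta> (\<xi> (Suc t)) p' y"
    by auto
  have z: "admissible B (\<xi> (Suc t))" using Suc.prems(1) by simp
  have IH: "\<forall>s. x' s \<in> choices" "\<And>j. 0 \<le> p' $ j" "norm p' \<le> G"
    "\<And>j. (\<Sum>s=1..t. (adjusted_use n \<psi> (\<xi> s) *v x' s) $ j) - real t * \<delta> $ j \<le> sqrt (real n) * p' $ j"
    using Suc.IH[OF Suc.prems(1) *(1)] by auto
  have y: "y \<in> choices" using set_pmf_decision(1)[OF tie *(2)] .
  have scale: "sqrt (real n) * (a + 1 / sqrt (real n) * b) = sqrt (real n) * a + b" for a b
    using sqrt_n(2) by (simp add: field_simps)
  have "(\<Sum>s=1..Suc t. (adjusted_use n \<psi> (\<xi> s) *v x s) $ j) - real (Suc t) * \<delta> $ j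
      \<le> sqrt (real n) * p $ j" for j
  proof -
    have "(\<Sum>s=1..Suc t. (adjusted_use n \<psi> (\<xi> s) *v x s) $ j) =
        (\<Sum>s=1..t. (adjusted_use n \<psi> (\<xi> s) *v x' s) $ j) + (adjusted_use n \<psi> (\<xi> (Suc t)) *v y) $ j"
      by (simp add: *(3))
    moreover have "(p' + (1 / sqrt (real n)) *\<^sub>R (adjusted_use n \<psi> (\<xi> (Suc t)) *v y - \<delta>)) $ j \<le> p $ j"
      unfolding *(4) price_update_def by (rule le_pos_part)
    hence "sqrt (real n) * (p' $ j + (1 / sqrt (real n)) * ((adjusted_use n \<psi> (\<xi> (Suc t)) *v y) $ j - \<delta> $ j))
       \<le> sqrt (real n) * p $ j"
      using sqrt_n(1) by (intro mult_left_mono) auto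
    hence "sqrt (real n) * p' $ j + ((adjusted_use n \<psi> (\<xi> (Suc t)) *v y) $ j - \<delta> $ j) \<le> sqrt (real n) * p $ j"
      by (simp only: scale)
    moreover have "real (Suc t) * \<delta> $ j = real t * \<delta> $ j + \<delta> $ j"
      by (simp add: distrib_right)
    ultimately show ?thesis using IH(4)[of j] by linarith
  qed
  moreover have "0 \<le> p $ j" for j unfolding *(4) price_update_def by (simp add: pos_part_nonneg)
  moreover have "norm p \<le> G" unfolding *(4) by (rule price_update_bounded[OF z IH(2,3) *(2)])
  moreover have "x s \<in> choices" for s unfolding *(3) using IH(1) y by simp
  ultimately show ?case by (intro conjI allI)
qed

end

section \<open>Feasibility, weak duality and the potential\<close>

definition subsimplex :: "(real^'k) set" where
  "subsimplex = {y. (\<Sum>l\<in>UNIV. y $ l) \<le> 1 \<and> (\<forall>l. 0 \<le> y $ l)}"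

lemma zero_in_subsimplex: "0 \<in> subsimplex"
  by (simp add: subsimplex_def)

lemma choices_subset_subsimplex: "choices \<subseteq> subsimplex"
  by (auto simp: choices_def subsimplex_def axis_def)

lemma scale_subsimplex:
  assumes "0 \<le> a" "a \<le> 1" "y \<in> subsimplex" shows "a *\<^sub>R y \<in> subsimplex"
proof -
  have "(\<Sum>l\<in>UNIV. a * y $ l) \<le> 1 * 1"
    unfolding sum_distrib_left[symmetric] using assms
    by (intro mult_mono) (auto simp: subsimplex_def sum_nonneg)
  thus ?thesis using assms by (simp add: subsimplex_def)
qed

lemma norm_subsimplex: "y \<in> subsimplex \<Longrightarrow> norm y \<le> 1"
  using norm_le_l1_cart[of y] by (simp add: subsimplex_def)

text \<open>The coordinates of \<open>y\<close> sum to at most 1, possibly less, hence the condition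
  \<open>0 \<le> c\<close>. This makes \<open>best_reward\<close> an upper bound for fractional
  decisions as well.\<close>

lemma inner_subsimplex_le:
  fixes g y :: "real^'k"
  assumes "y \<in> subsimplex" "\<And>l. g $ l \<le> c" "0 \<le> c" shows "g \<bullet> y \<le> c"
proof -
  have "g \<bullet> y \<le> (\<Sum>l\<in>UNIV. c * y $ l)"
    unfolding inner_vec_def using assms by (auto simp: subsimplex_def intro!: sum_mono mult_right_mono)
  also have "\<dots> \<le> c"
    unfolding sum_distrib_left[symmetric] using assms
    by (auto simp: subsimplex_def intro: mult_left_le)
  finally show ?thesis .
qed

lemma socp_feasible_iff:
  "x \<in> socp_feasible n \<psi> b \<xi> \<longleftrightarrow>
     (\<forall>j. cone_lhs n \<psi> \<xi> x $ j \<le> b $ j) \<and> (\<forall>t\<in>{1..n}. x t \<in> subsimplex)"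
  by (simp add: socp_feasible_def subsimplex_def)

text \<open>The bound uses the actual norms of the rewards instead of \<open>B\<close>: the supremum
  in \<open>socp_value\<close> has to be a genuine one for every sequence of requests when its
  measurability is proved.\<close>

lemma objective_le_sum_norm:
  assumes "\<And>t. t \<in> {1..n} \<Longrightarrow> x t \<in> subsimplex"
  shows "objective n \<xi> x \<le> (\<Sum>t=1..n. norm (reward (\<xi> t)))"
  unfolding objective_def
proof (rule sum_mono)
  fix t assume "t \<in> {1..n}"
  have "reward (\<xi> t) \<bullet> x t \<le> norm (reward (\<xi> t)) * norm (x t)" by (rule norm_cauchy_schwarz)
  also have "\<dots> \<le> norm (reward (\<xi> t))"
    using norm_subsimplex[OF assms[OF \<open>t \<in> {1..n}\<close>]] by (simp add: mult_left_le)
  finally show "reward (\<xi> t) \<bullet> x t \<le> norm (reward (\<xi> t))" .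
qed

lemma zero_feasible: "(\<And>j. 0 \<le> b $ j) \<Longrightarrow> (\<lambda>_. 0) \<in> socp_feasible n \<psi> b \<xi>"
  by (simp add: socp_feasible_iff zero_in_subsimplex cone_lhs_def)

lemma bdd_above_objective: "bdd_above (objective n \<xi> ` socp_feasible n \<psi> b \<xi>)"
  by (rule bdd_aboveI2[OF objective_le_sum_norm]) (simp add: socp_feasible_iff)

lemma objective_le_socp_value:
  "x \<in> socp_feasible n \<psi> b \<xi> \<Longrightarrow> objective n \<xi> x \<le> socp_value n \<psi> b \<xi>"
  unfolding socp_value_def by (intro cSUP_upper bdd_above_objective)

lemma socp_value_le:
  assumes "\<And>j. 0 \<le> b $ j" "\<And>x. x \<in> socp_feasible n \<psi> b \<xi> \<Longrightarrow> objective n \<xi> x \<le> c"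
  shows "socp_value n \<psi> b \<xi> \<le> c"
  unfolding socp_value_def using zero_feasible[of b n \<psi> \<xi>, OF assms(1)] assms(2)
  by (intro cSUP_least) blast+

text \<open>The cone term is positively homogeneous, since the factor \<open>a^2\<close> leaves the
  square root as \<open>a\<close>. This is what allows an infeasible output to be shrunk into the
  feasible set.\<close>

lemma cone_lhs_scale:
  assumes "0 \<le> a" shows "cone_lhs n \<psi> \<xi> (\<lambda>t. a *\<^sub>R x t) $ j = a * cone_lhs n \<psi> \<xi> x $ j"
proof -
  have "(\<Sum>t=1..n. (a *\<^sub>R x t) \<bullet> (cov_use (\<xi> t) $ j *v (a *\<^sub>R x t))) =
      a\<^sup>2 * (\<Sum>t=1..n. x t \<bullet> (cov_use (\<xi> t) $ j *v x t))"
    by (simp add: sum_distrib_left power2_eq_square matrix_vector_mult_scaleR mult.assoc)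
  moreover have "(\<Sum>t=1..n. mean_use (\<xi> t) $ j \<bullet> (a *\<^sub>R x t)) = a * (\<Sum>t=1..n. mean_use (\<xi> t) $ j \<bullet> x t)"
    by (simp add: sum_distrib_left)
  ultimately show ?thesis
    using assms by (simp only: cone_lhs_def real_sqrt_mult vec_lambda_beta) (simp add: distrib_left)
qed

lemma objective_scale: "objective n \<xi> (\<lambda>t. a *\<^sub>R x t) = a * objective n \<xi> x"
  by (simp add: objective_def sum_distrib_left)

lemma adjusted_use_mult:
  "(adjusted_use n \<psi> z *v y) $ j =
     mean_use z $ j \<bullet> y + \<psi> $ j / sqrt (real n) * ((\<chi> l. sqrt (cov_use z $ j $ l $ l)) \<bullet> y)"
  by (simp add: matrix_vector_mul_component adjusted_use_def inner_add_left)

section \<open>Violation and lower bound of the gap, valid for every run\<close>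

text \<open>Per round, pricing the adjusted use instead of the mean use changes the cost by at most
  \<open>norm p * psi_weight B \<psi> / sqrt n\<close>.\<close>

definition psi_weight :: "real \<Rightarrow> real^'m \<Rightarrow> real" where
  "psi_weight B \<psi> = (\<Sum>j\<in>UNIV. \<psi> $ j * sqrt B)"

text \<open>For each resource, the price bound covers the accumulated overuse and
  \<open>\<psi> $ j * sqrt B\<close> the cone term, both in units of \<open>sqrt n\<close>; the sum
  passes from coordinates to the Euclidean norm.\<close>

definition violation_bound :: "real \<Rightarrow> real^'m \<Rightarrow> real \<Rightarrow> real \<Rightarrow> real" where
  "violation_bound B \<psi> dl du = (\<Sum>j\<in>UNIV. price_bound B \<psi> dl du + \<psi> $ j * sqrt B)"

context online_socp
begin

abbreviation "V \<equiv> violation_bound B \<psi> dl du"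
abbreviation "S \<equiv> psi_weight B \<psi>"

lemma n_divide_sqrt: "real n * (c / sqrt (real n)) = c * sqrt (real n)"
  using sqrt_n(2) by (simp add: divide_eq_eq mult.assoc)

lemma psi_sqrt_nonneg: "0 \<le> \<psi> $ j * sqrt B"
  using psi_pos[of j] B_nonneg by simp

lemma V_component: "G + \<psi> $ j * sqrt B \<le> V"
  unfolding violation_bound_def
  by (rule member_le_sum[where f="\<lambda>j. G + \<psi> $ j * sqrt B"])
     (use G_nonneg psi_sqrt_nonneg in \<open>auto intro: add_nonneg_nonneg\<close>)

lemma V_nonneg: "0 \<le> V"
  unfolding violation_bound_def by (intro sum_nonneg add_nonneg_nonneg G_nonneg psi_sqrt_nonneg)

lemma S_nonneg: "0 \<le> S"
  unfolding psi_weight_def by (intro sum_nonneg psi_sqrt_nonneg)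

text \<open>At a unit vector the quadratic form is a single diagonal entry, at most
  \<open>B\<close>; hence the sum under the root is at most \<open>n * B\<close>. The safety margin
  in the adjusted use is nonnegative.\<close>

lemma cone_lhs_choices:
  assumes \<xi>: "\<And>s. s \<in> {1..n} \<Longrightarrow> admissible B (\<xi> s)" and x: "\<And>s. x s \<in> choices"
  shows "cone_lhs n \<psi> \<xi> x $ j \<le>
    (\<Sum>s=1..n. (adjusted_use n \<psi> (\<xi> s) *v x s) $ j) + sqrt (real n) * (\<psi> $ j * sqrt B)"
proof -
  have "mean_use (\<xi> s) $ j \<bullet> x s \<le> (adjusted_use n \<psi> (\<xi> s) *v x s) $ j" if "s \<in> {1..n}" for s
  proof -
    have "0 \<le> (\<chi> l. sqrt (cov_use (\<xi> s) $ j $ l $ l)) \<bullet> x s"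
      using x[of s] admissible_cov_diag(1)[OF \<xi>[OF that]]
      by (elim choices_cases) (simp_all add: inner_axis)
    from mult_nonneg_nonneg[OF psi_scaled(2)[of j] this] show ?thesis
      unfolding adjusted_use_mult by linarith
  qed
  moreover have "x s \<bullet> (cov_use (\<xi> s) $ j *v x s) \<le> B" if "s \<in> {1..n}" for s
    using x[of s] admissible_cov_diag(2)[OF \<xi>[OF that]] B_nonneg
    by (elim choices_cases) (simp_all add: inner_matrix_axis)
  hence "(\<Sum>s=1..n. x s \<bullet> (cov_use (\<xi> s) $ j *v x s)) \<le> real n * B"
    using sum_mono[of "{1..n}" _ "\<lambda>_. B"] by simp
  hence "sqrt (\<Sum>s=1..n. x s \<bullet> (cov_use (\<xi> s) $ j *v x s)) \<le> sqrt (real n) * sqrt B"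
    by (simp add: real_sqrt_mult[symmetric])
  hence "\<psi> $ j * sqrt (\<Sum>s=1..n. x s \<bullet> (cov_use (\<xi> s) $ j *v x s)) \<le>
      \<psi> $ j * (sqrt (real n) * sqrt B)"
    using psi_pos[of j] by (intro mult_left_mono) auto
  moreover have "cone_lhs n \<psi> \<xi> x $ j = (\<Sum>s=1..n. mean_use (\<xi> s) $ j \<bullet> x s) +
      \<psi> $ j * sqrt (\<Sum>s=1..n. x s \<bullet> (cov_use (\<xi> s) $ j *v x s))"
    by (simp add: cone_lhs_def)
  ultimately show ?thesis
    by (simp only: mult.left_commute[of "sqrt (real n)"]) (intro add_mono sum_mono; simp)
qed

text \<open>By the invariant, the bound \<open>G\<close> on the final price is a bound
  \<open>sqrt n * G\<close> on the overuse measured by the adjusted use; the cone term adds the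
  rest.\<close>

lemma run_violation:
  assumes \<xi>: "\<And>s. s \<in> {1..n} \<Longrightarrow> admissible B (\<xi> s)"
    and x: "x \<in> set_pmf (algorithm_output n \<psi> \<delta> tie \<xi>)"
  shows "cone_lhs n \<psi> \<xi> x $ j - real n * \<delta> $ j \<le> sqrt (real n) * (G + \<psi> $ j * sqrt B)"
    "x s \<in> choices"
proof -
  from x obtain p where "(x, p) \<in> set_pmf (run n \<psi> \<delta> tie \<xi> n)"
    by (auto simp: algorithm_output_def)
  note inv = run_invariant[OF \<xi> this]
  show "x s \<in> choices" using inv by blast
  have "cone_lhs n \<psi> \<xi> x $ j \<le>
      (\<Sum>s=1..n. (adjusted_use n \<psi> (\<xi> s) *v x s) $ j) + sqrt (real n) * (\<psi> $ j * sqrt B)"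
    using inv by (intro cone_lhs_choices \<xi>) auto
  moreover have "p $ j \<le> G"
    using inv component_le_norm_cart[of p j] by linarith
  hence "sqrt (real n) * p $ j \<le> sqrt (real n) * G" by (rule mult_left_mono) simp
  moreover have "(\<Sum>s=1..n. (adjusted_use n \<psi> (\<xi> s) *v x s) $ j) - real n * \<delta> $ j \<le> sqrt (real n) * p $ j"
    using inv by blast
  ultimately show "cone_lhs n \<psi> \<xi> x $ j - real n * \<delta> $ j \<le> sqrt (real n) * (G + \<psi> $ j * sqrt B)"
    unfolding distrib_left by linarith
qed

lemma norm_violation:
  assumes "\<And>s. s \<in> {1..n} \<Longrightarrow> admissible B (\<xi> s)"
    and "x \<in> set_pmf (algorithm_output n \<psi> \<delta> tie \<xi>)"
  shows "norm (pos_part (cone_lhs n \<psi> \<xi> x - real n *\<^sub>R \<delta>)) \<le> V * sqrt (real n)"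
proof -
  have "\<bar>pos_part (cone_lhs n \<psi> \<xi> x - real n *\<^sub>R \<delta>) $ j\<bar> \<le> sqrt (real n) * (G + \<psi> $ j * sqrt B)" for j
    using run_violation(1)[OF assms, of j] G_nonneg psi_sqrt_nonneg[of j]
    by (auto simp: pos_part_def max_def)
  hence "norm (pos_part (cone_lhs n \<psi> \<xi> x - real n *\<^sub>R \<delta>)) \<le>
      (\<Sum>j\<in>UNIV. sqrt (real n) * (G + \<psi> $ j * sqrt B))"
    by (intro order_trans[OF norm_le_l1_cart] sum_mono)
  thus ?thesis by (simp add: violation_bound_def sum_distrib_left mult.commute)
qed

lemma b_nonneg: "0 \<le> (real n *\<^sub>R \<delta>) $ j"
  using delta_pos[of j] by simp

lemma objective_bounds:
  assumes \<xi>: "\<And>s. s \<in> {1..n} \<Longrightarrow> admissible B (\<xi> s)" and x: "\<And>s. x s \<in> choices"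
  shows "\<bar>objective n \<xi> x\<bar> \<le> real n * B"
proof -
  have "\<bar>objective n \<xi> x\<bar> \<le> (\<Sum>s=1..n. B)"
    unfolding objective_def
    by (intro order_trans[OF sum_abs] sum_mono reward_choices \<xi> x)
  thus ?thesis by simp
qed

lemma socp_value_bounds:
  assumes \<xi>: "\<And>s. s \<in> {1..n} \<Longrightarrow> admissible B (\<xi> s)"
  shows "0 \<le> socp_value n \<psi> (real n *\<^sub>R \<delta>) \<xi>" "socp_value n \<psi> (real n *\<^sub>R \<delta>) \<xi> \<le> real n * B"
proof -
  have "objective n \<xi> (\<lambda>_. 0) \<le> socp_value n \<psi> (real n *\<^sub>R \<delta>) \<xi>"
    by (intro objective_le_socp_value zero_feasible b_nonneg)
  thus "0 \<le> socp_value n \<psi> (real n *\<^sub>R \<delta>) \<xi>" by (simp add: objective_def)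
  show "socp_value n \<psi> (real n *\<^sub>R \<delta>) \<xi> \<le> real n * B"
  proof (intro socp_value_le b_nonneg)
    fix x assume "x \<in> socp_feasible n \<psi> (real n *\<^sub>R \<delta>) \<xi>"
    hence "objective n \<xi> x \<le> (\<Sum>t=1..n. norm (reward (\<xi> t)))"
      by (intro objective_le_sum_norm) (auto simp: socp_feasible_iff)
    also have "\<dots> \<le> (\<Sum>t=1..n. B)" by (intro sum_mono admissible_reward \<xi>)
    finally show "objective n \<xi> x \<le> real n * B" by simp
  qed
qed

text \<open>The output violates the constraints by at most \<open>V * sqrt n\<close>, so that shrinking it by the
  factor \<open>n * dl / (n * dl + V * sqrt n)\<close> makes it feasible.\<close>
lemma objective_le_socp_value_plus:
  assumes \<xi>: "\<And>s. s \<in> {1..n} \<Longrightarrow> admissible B (\<xi> s)"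
    and x: "x \<in> set_pmf (algorithm_output n \<psi> \<delta> tie \<xi>)"
  shows "objective n \<xi> x \<le> socp_value n \<psi> (real n *\<^sub>R \<delta>) \<xi> + B * V / dl * sqrt (real n)"
proof -
  define q where "q = real n * dl"
  define v where "v = V * sqrt (real n)"
  define a where "a = q / (q + v)"
  have q: "0 < q" unfolding q_def using sqrt_n(2) dl_pos by simp
  have v: "0 \<le> v" unfolding v_def using V_nonneg by simp
  have a: "0 \<le> a" "a \<le> 1" using q v by (auto simp: a_def field_simps)
  have "(\<lambda>t. a *\<^sub>R x t) \<in> socp_feasible n \<psi> (real n *\<^sub>R \<delta>) \<xi>"
    unfolding socp_feasible_iff
  proof (intro conjI allI ballI)
    fix j
    define w where "w = real n * \<delta> $ j"
    have w: "q \<le> w" unfolding q_def w_def using delta_lower[of j] sqrt_n(2) by simp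
    have "sqrt (real n) * (G + \<psi> $ j * sqrt B) \<le> sqrt (real n) * V"
      by (intro mult_left_mono V_component) simp
    hence "cone_lhs n \<psi> \<xi> x $ j \<le> w + v"
      using run_violation(1)[OF \<xi> x, of j] unfolding v_def w_def by (simp add: mult.commute)
    hence "a * cone_lhs n \<psi> \<xi> x $ j \<le> a * (w + v)" using a by (intro mult_left_mono)
    also have "\<dots> \<le> w"
    \<comment> \<open>One factor serves all resources: \<open>w / (w + v)\<close> increases with the
      budget \<open>w\<close>, and \<open>q\<close> is a lower bound for every budget.\<close>
    proof -
      have "q * (w + v) \<le> w * (q + v)" using mult_right_mono[OF w v] by (simp add: algebra_simps)
      thus ?thesis using q v unfolding a_def by (simp add: field_simps)
    qed
    finally show "cone_lhs n \<psi> \<xi> (\<lambda>t. a *\<^sub>R x t) $ j \<le> (real n *\<^sub>R \<delta>) $ j"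
      unfolding cone_lhs_scale[OF a(1)] w_def by simp
  next
    fix t show "a *\<^sub>R x t \<in> subsimplex"
      using run_violation(2)[OF \<xi> x] choices_subset_subsimplex a by (auto intro: scale_subsimplex)
  qed
  hence "a * objective n \<xi> x \<le> socp_value n \<psi> (real n *\<^sub>R \<delta>) \<xi>"
    unfolding objective_scale[symmetric] by (rule objective_le_socp_value)
  \<comment> \<open>Shrinking loses the fraction \<open>1 - a\<close>, at most
    \<open>v / q = V / (dl * sqrt n)\<close>, of an objective that is at most
    \<open>n * B\<close>.\<close>
  moreover have "(1 - a) * objective n \<xi> x \<le> B * V / dl * sqrt (real n)"
  proof -
    have "(1 - a) * objective n \<xi> x \<le> (1 - a) * (real n * B)"
      using objective_bounds[of \<xi> x, OF \<xi> run_violation(2)[OF \<xi> x]] a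
      by (intro mult_left_mono) auto
    also have "\<dots> \<le> v / q * (real n * B)"
    proof (rule mult_right_mono)
      have "1 - a = v / (q + v)" using q v by (simp add: a_def field_simps)
      also have "\<dots> \<le> v / q" using q v by (intro divide_left_mono) auto
      finally show "1 - a \<le> v / q" .
    qed (use B_nonneg in simp)
    also have "\<dots> = B * V / dl * sqrt (real n)"
      unfolding q_def v_def using sqrt_n(2) by simp
    finally show ?thesis .
  qed
  ultimately show ?thesis by (simp add: algebra_simps)
qed

section \<open>Weak duality and one step of the potential\<close>

text \<open>Weak duality at an arbitrary price \<open>p\<close>. Each feasible \<open>x t\<close>
  earns at most \<open>best_reward\<close> plus the priced adjusted use. The mean use costs at most
  \<open>n * (p \<bullet> \<delta>)\<close> in total by feasibility, and the margins cost
  \<open>norm p * S / sqrt n\<close> in each of the \<open>n\<close> rounds.\<close>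

lemma socp_value_le_dual:
  assumes \<xi>: "\<And>s. s \<in> {1..n} \<Longrightarrow> admissible B (\<xi> s)" and p: "\<And>j. 0 \<le> p $ j"
  shows "socp_value n \<psi> (real n *\<^sub>R \<delta>) \<xi> \<le>
    (\<Sum>t=1..n. dual_term n \<psi> \<delta> (\<xi> t) p) + norm p * S * sqrt (real n)"
proof (intro socp_value_le b_nonneg)
  fix x assume "x \<in> socp_feasible n \<psi> (real n *\<^sub>R \<delta>) \<xi>"
  hence cone: "\<And>j. cone_lhs n \<psi> \<xi> x $ j \<le> real n * \<delta> $ j"
    and x: "\<And>t. t \<in> {1..n} \<Longrightarrow> x t \<in> subsimplex"
    by (auto simp: socp_feasible_iff)
  define m where "m t = (\<Sum>j\<in>UNIV. p $ j * (mean_use (\<xi> t) $ j \<bullet> x t))" for t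
  have "reward (\<xi> t) \<bullet> x t \<le> best_reward n \<psi> (\<xi> t) p + m t + norm p * S / sqrt (real n)"
    if t: "t \<in> {1..n}" for t
  proof -
    have "reduced_reward n \<psi> (\<xi> t) p \<bullet> x t \<le> best_reward n \<psi> (\<xi> t) p"
      by (rule inner_subsimplex_le[OF x[OF t]]) (auto simp: best_reward_def le_max_iff_disj)
    moreover have "p \<bullet> (adjusted_use n \<psi> (\<xi> t) *v x t) \<le> m t + norm p * S / sqrt (real n)"
    proof -
      have "p $ j * (\<psi> $ j / sqrt (real n) * ((\<chi> l. sqrt (cov_use (\<xi> t) $ j $ l $ l)) \<bullet> x t)) \<le>
          norm p * (\<psi> $ j / sqrt (real n) * sqrt B)" for j
      proof -
        have "\<psi> $ j / sqrt (real n) * ((\<chi> l. sqrt (cov_use (\<xi> t) $ j $ l $ l)) \<bullet> x t)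
            \<le> \<psi> $ j / sqrt (real n) * sqrt B"
          using admissible_cov_diag(2)[OF \<xi>[OF t]] B_nonneg psi_scaled(2)[of j]
          by (intro mult_left_mono inner_subsimplex_le[OF x[OF t]]) auto
        moreover have "p $ j \<le> norm p" using component_le_norm_cart[of p j] by simp
        moreover have "0 \<le> \<psi> $ j / sqrt (real n) * sqrt B"
          using psi_scaled(2)[of j] B_nonneg by (intro mult_nonneg_nonneg) auto
        ultimately show ?thesis
          using p[of j] by (meson mult_left_mono mult_right_mono order_trans)
      qed
      hence "(\<Sum>j\<in>UNIV. p $ j * (\<psi> $ j / sqrt (real n) * ((\<chi> l. sqrt (cov_use (\<xi> t) $ j $ l $ l)) \<bullet> x t)))
          \<le> (\<Sum>j\<in>UNIV. norm p * (\<psi> $ j / sqrt (real n) * sqrt B))"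
        by (intro sum_mono)
      also have "\<dots> = norm p * S / sqrt (real n)"
        by (simp add: psi_weight_def sum_distrib_left sum_divide_distrib)
      finally show ?thesis
        by (simp add: inner_vec_def[of p] adjusted_use_mult distrib_left sum.distrib m_def)
    qed
    ultimately show ?thesis by (simp add: reduced_reward_inner)
  qed
  hence "objective n \<xi> x \<le>
      (\<Sum>t=1..n. best_reward n \<psi> (\<xi> t) p + m t + norm p * S / sqrt (real n))"
    unfolding objective_def by (rule sum_mono)
  also have "\<dots> = (\<Sum>t=1..n. best_reward n \<psi> (\<xi> t) p) + (\<Sum>t=1..n. m t) + norm p * S * sqrt (real n)"
    by (simp add: sum.distrib n_divide_sqrt del: times_divide_eq_right)
  also have "(\<Sum>t=1..n. m t) \<le> real n * (p \<bullet> \<delta>)"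
  proof -
    \<comment> \<open>Positive semidefiniteness makes the cone term nonnegative, so dropping it from
      the constraint leaves a linear budget for the mean use.\<close>
    have "(\<Sum>t=1..n. mean_use (\<xi> t) $ j \<bullet> x t) \<le> real n * \<delta> $ j" for j
    proof -
      have "0 \<le> x t \<bullet> (cov_use (\<xi> t) $ j *v x t)" if "t \<in> {1..n}" for t
        using \<xi>[OF that] by (auto simp: admissible_def covariance_matrix_def)
      hence "0 \<le> \<psi> $ j * sqrt (\<Sum>t=1..n. x t \<bullet> (cov_use (\<xi> t) $ j *v x t))"
        using psi_pos[of j] by (intro mult_nonneg_nonneg real_sqrt_ge_zero sum_nonneg) auto
      thus ?thesis using cone[of j] by (simp add: cone_lhs_def)
    qed
    hence "(\<Sum>j\<in>UNIV. p $ j * (\<Sum>t=1..n. mean_use (\<xi> t) $ j \<bullet> x t)) \<le>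
        (\<Sum>j\<in>UNIV. p $ j * (real n * \<delta> $ j))"
      using p by (intro sum_mono mult_left_mono)
    thus ?thesis
      unfolding m_def by (subst sum.swap)
        (simp add: sum_distrib_left inner_vec_def[of p] mult.left_commute)
  qed
  finally show "objective n \<xi> x \<le>
      (\<Sum>t=1..n. dual_term n \<psi> \<delta> (\<xi> t) p) + norm p * S * sqrt (real n)"
    by (simp add: dual_term_def sum.distrib)
qed

text \<open>The decision attains the maximum, so its reward is the dual term plus
  \<open>p \<bullet> (adjusted_use n \<psi> z *v y - \<delta>)\<close>. Up to the factor
  \<open>2 / sqrt n\<close>, this inner product is the first-order term in the growth of the squared
  price.\<close>

lemma potential_step:
  assumes z: "admissible B z" and y: "y \<in> set_pmf (decision n \<psi> tie z p)"
  shows "dual_term n \<psi> \<delta> z p - M\<^sup>2 / (2 * sqrt (real n)) \<le>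
    reward z \<bullet> y - sqrt (real n) / 2 * ((norm (price_update n \<psi> \<delta> z p y))\<^sup>2 - (norm p)\<^sup>2)"
proof -
  define s where "s = sqrt (real n)"
  define c where "c = p \<bullet> (adjusted_use n \<psi> z *v y - \<delta>)"
  define N where "N = (norm (price_update n \<psi> \<delta> z p y))\<^sup>2 - (norm p)\<^sup>2"
  have s: "0 < s" "real n = s * s" using sqrt_n by (auto simp: s_def)
  have "N \<le> 2 / s * c + M\<^sup>2 / (s * s)"
    using norm_price_update(2)[OF z set_pmf_decision(1)[OF tie y], of p]
    unfolding N_def c_def s_def using sqrt_n(3) by simp
  hence "s / 2 * N \<le> s / 2 * (2 / s * c + M\<^sup>2 / (s * s))" using s by (intro mult_left_mono) auto
  also have "\<dots> = c + M\<^sup>2 / (2 * s)" using s by (simp add: field_simps)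
  finally have "s / 2 * N \<le> c + M\<^sup>2 / (2 * s)" .
  moreover have "reward z \<bullet> y = best_reward n \<psi> z p + (c + p \<bullet> \<delta>)"
    using set_pmf_decision(2)[OF tie y]
    by (simp add: reduced_reward_inner c_def inner_diff_right)
  ultimately show ?thesis unfolding s_def[symmetric] N_def[symmetric] dual_term_def by linarith
qed

end

section \<open>Averaging over the tie-breaking\<close>

lemma integrable_run: "integrable (measure_pmf (run n \<psi> \<delta> tie \<xi> t)) (h :: _ \<Rightarrow> real)"
  by (rule integrable_measure_pmf_finite[OF finite_run])

lemma expectation_run_Suc:
  fixes h :: "_ \<Rightarrow> real"
  shows "measure_pmf.expectation (run n \<psi> \<delta> tie \<xi> (Suc t)) h =
    measure_pmf.expectation (run n \<psi> \<delta> tie \<xi> t) (\<lambda>(x, p).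
      measure_pmf.expectation (decision n \<psi> tie (\<xi> (Suc t)) p)
        (\<lambda>y. h (x(Suc t := y), price_update n \<psi> \<delta> (\<xi> (Suc t)) p y)))"
proof -
  let ?f = "\<lambda>(x, p). map_pmf (\<lambda>y. (x(Suc t := y), price_update n \<psi> \<delta> (\<xi> (Suc t)) p y))
     (decision n \<psi> tie (\<xi> (Suc t)) p)"
  have "measure_pmf.expectation (run n \<psi> \<delta> tie \<xi> (Suc t)) h =
    (\<Sum>a\<in>set_pmf (run n \<psi> \<delta> tie \<xi> t).
       pmf (run n \<psi> \<delta> tie \<xi> t) a *\<^sub>R measure_pmf.expectation (?f a) h)"
    unfolding run.simps
    by (rule pmf_expectation_bind[OF finite_run]) (auto simp: finite_decision)
  also have "\<dots> = measure_pmf.expectation (run n \<psi> \<delta> tie \<xi> t) (\<lambda>a. measure_pmf.expectation (?f a) h)"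
    by (rule integral_measure_pmf[OF finite_run, symmetric])
  finally show ?thesis by (simp only: case_prod_unfold integral_map_pmf)
qed

context online_socp
begin

text \<open>Expected reward so far minus the potential \<open>sqrt n / 2 * (norm p)^2\<close>; the
  weight \<open>sqrt n / 2\<close> turns the first-order term of the squared price into a
  cost.\<close>

definition run_potential :: "(nat \<Rightarrow> ('m, 'k) request) \<Rightarrow> nat \<Rightarrow> real" where
  "run_potential \<xi> t = measure_pmf.expectation (run n \<psi> \<delta> tie \<xi> t)
     (\<lambda>(x, p). (\<Sum>s=1..t. reward (\<xi> s) \<bullet> x s) - sqrt (real n) / 2 * (norm p)\<^sup>2)"

text \<open>The request \<open>z\<close> is kept apart from the path \<open>\<xi>\<close> that
  produced the price, so that it can be integrated on its own.\<close>

definition round_dual :: "(nat \<Rightarrow> ('m, 'k) request) \<Rightarrow> nat \<Rightarrow> ('m, 'k) request \<Rightarrow> real" where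
  "round_dual \<xi> t z =
     measure_pmf.expectation (run n \<psi> \<delta> tie \<xi> t) (\<lambda>(x, p). dual_term n \<psi> \<delta> z p)"

lemma run_potential_Suc:
  assumes "admissible B (\<xi> (Suc t))"
  shows "run_potential \<xi> t + round_dual \<xi> t (\<xi> (Suc t)) - M\<^sup>2 / (2 * sqrt (real n))
    \<le> run_potential \<xi> (Suc t)"
proof -
  define c where "c = M\<^sup>2 / (2 * sqrt (real n))"
  define f where "f = (\<lambda>(x, p). (\<Sum>s=1..t. reward (\<xi> s) \<bullet> x s) - sqrt (real n) / 2 * (norm (p :: real^'m))\<^sup>2)"
  define g where "g = (\<lambda>(x :: nat \<Rightarrow> real^'k, p). dual_term n \<psi> \<delta> (\<xi> (Suc t)) p)"
  have "run_potential \<xi> t + round_dual \<xi> t (\<xi> (Suc t)) - c =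
      measure_pmf.expectation (run n \<psi> \<delta> tie \<xi> t) (\<lambda>a. f a + g a - c)"
    unfolding run_potential_def round_dual_def f_def[symmetric] g_def[symmetric]
    by (simp add: integrable_run)
  also have "\<dots> \<le> run_potential \<xi> (Suc t)"
    unfolding run_potential_def expectation_run_Suc
  proof (intro integral_mono integrable_run, goal_cases)
    case (1 a)
    obtain x p where a: "a = (x, p)" by fastforce
    let ?D = "decision n \<psi> tie (\<xi> (Suc t)) p"
    have "measure_pmf.expectation ?D (\<lambda>_. f (x, p) + g (x, p) - c) \<le>
      measure_pmf.expectation ?D (\<lambda>y. (\<Sum>s=1..Suc t. reward (\<xi> s) \<bullet> (x(Suc t := y)) s) -
         sqrt (real n) / 2 * (norm (price_update n \<psi> \<delta> (\<xi> (Suc t)) p y))\<^sup>2)"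
    proof (intro integral_mono_AE integrable_measure_pmf_finite finite_decision AE_pmfI)
      fix y assume "y \<in> set_pmf ?D"
      from potential_step[OF assms this]
      show "f (x, p) + g (x, p) - c \<le> (\<Sum>s=1..Suc t. reward (\<xi> s) \<bullet> (x(Suc t := y)) s) -
         sqrt (real n) / 2 * (norm (price_update n \<psi> \<delta> (\<xi> (Suc t)) p y))\<^sup>2"
        by (simp add: f_def g_def c_def right_diff_distrib)
    qed
    thus ?case by (simp add: a)
  qed
  finally show ?thesis unfolding c_def .
qed

text \<open>Telescoping: the potential starts at 0 because the first price is 0, and the final
  squared price has a favourable sign and is dropped. The \<open>n\<close> errors
  \<open>M^2 / (2 * sqrt n)\<close> add up to \<open>M^2 / 2 * sqrt n\<close>.\<close>

lemma sum_round_dual_le: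
  assumes "\<And>s. s \<in> {1..n} \<Longrightarrow> admissible B (\<xi> s)"
  shows "(\<Sum>t<n. round_dual \<xi> t (\<xi> (Suc t))) - M\<^sup>2 / 2 * sqrt (real n) \<le>
    measure_pmf.expectation (algorithm_output n \<psi> \<delta> tie \<xi>) (objective n \<xi>)"
proof -
  have "(\<Sum>s<t. round_dual \<xi> s (\<xi> (Suc s))) - real t * (M\<^sup>2 / (2 * sqrt (real n))) \<le> run_potential \<xi> t"
    if "t \<le> n" for t
    using that
  proof (induction t)
    case 0
    show ?case by (simp add: run_potential_def)
  next
    case (Suc t)
    thus ?case using run_potential_Suc[of \<xi> t, OF assms]
      by (simp add: add_divide_distrib distrib_right)
  qed
  from this[of n] have "(\<Sum>t<n. round_dual \<xi> t (\<xi> (Suc t))) - M\<^sup>2 / 2 * sqrt (real n) \<le> run_potential \<xi> n"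
    using n_divide_sqrt[of "M\<^sup>2 / 2"] by (simp add: mult.commute)
  also have "\<dots> \<le> measure_pmf.expectation (run n \<psi> \<delta> tie \<xi> n) (\<lambda>a. objective n \<xi> (fst a))"
    unfolding run_potential_def
    by (intro integral_mono integrable_run) (auto simp: objective_def)
  finally show ?thesis by (simp add: algorithm_output_def)
qed

end

section \<open>Measurability\<close>

type_synonym ('m, 'k) run_state = "(nat \<Rightarrow> real^'k) \<times> (real^'m)"

section \<open>Upper semicontinuity of the optimal value\<close>

text \<open>By the tube lemma, a point whose fibre over \<open>K\<close> misses \<open>T\<close> has
  a neighbourhood with the same property.\<close>

lemma closed_projection_compact:
  assumes "compact K" "closed T"
  shows "closed {y. \<exists>x\<in>K. (y, x) \<in> T}"
proof -
  have "open (- {y. \<exists>x\<in>K. (y, x) \<in> T})"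
  proof (subst open_subopen, intro ballI)
    fix y assume "y \<in> - {y. \<exists>x\<in>K. (y, x) \<in> T}"
    hence "{y} \<times> K \<subseteq> - T" by auto
    from Elementary_Topology.tube_lemma[OF assms(1) _ this] assms(2)
    obtain U where "y \<in> U" "open U" "U \<times> K \<subseteq> - T" by auto
    thus "\<exists>U. open U \<and> y \<in> U \<and> U \<subseteq> - {y. \<exists>x\<in>K. (y, x) \<in> T}" by (intro exI[of _ U]) auto
  qed
  thus ?thesis by (simp add: open_closed)
qed

lemma compact_subsimplex: "compact (subsimplex :: (real^'k) set)"
proof -
  have "closed (subsimplex :: (real^'k) set)"
    unfolding subsimplex_def
    by (intro closed_Collect_conj closed_Collect_all closed_Collect_le continuous_intros)
  moreover have "bounded (subsimplex :: (real^'k) set)"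
    unfolding bounded_iff using norm_subsimplex by blast
  ultimately show ?thesis by (simp add: compact_eq_bounded_closed)
qed

text \<open>Tychonoff's theorem for the product topology on functions.\<close>

lemma compact_PiE_UNIV:
  fixes A :: "'b::topological_space set"
  assumes "compact A" shows "compact {x :: 'a \<Rightarrow> 'b. \<forall>t. x t \<in> A}"
proof -
  have "compactin (product_topology (\<lambda>_. euclidean) UNIV) (PiE (UNIV :: 'a set) (\<lambda>_. A))"
    using assms by (simp add: compactin_PiE)
  moreover have "PiE (UNIV :: 'a set) (\<lambda>_. A) = {x. \<forall>t. x t \<in> A}" by auto
  ultimately show ?thesis by (simp add: euclidean_product_topology)
qed

lemma continuous_on_reward [continuous_intros]:
  "continuous_on A f \<Longrightarrow> continuous_on A (\<lambda>w. reward (f w))"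
  unfolding reward_def by (intro continuous_intros)

lemma continuous_on_mean_use [continuous_intros]:
  "continuous_on A f \<Longrightarrow> continuous_on A (\<lambda>w. mean_use (f w))"
  unfolding mean_use_def by (intro continuous_intros)

lemma continuous_on_cov_use [continuous_intros]:
  "continuous_on A f \<Longrightarrow> continuous_on A (\<lambda>w. cov_use (f w))"
  unfolding cov_use_def by (intro continuous_intros)

lemma continuous_on_matrix_vector_mult [continuous_intros]:
  fixes f :: "_ \<Rightarrow> real^'k^'m"
  assumes "continuous_on A f" "continuous_on A g"
  shows "continuous_on A (\<lambda>w. f w *v g w)"
  unfolding matrix_vector_mult_def by (intro continuous_intros assms)

lemma continuous_on_vector_matrix_mult [continuous_intros]:
  fixes f :: "_ \<Rightarrow> real^'k^'m"
  assumes "continuous_on A f" "continuous_on A g"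
  shows "continuous_on A (\<lambda>w. g w v* f w)"
  unfolding vector_matrix_mult_def by (intro continuous_intros assms)

lemma continuous_on_adjusted_use [continuous_intros]:
  "continuous_on A f \<Longrightarrow> continuous_on A (\<lambda>w. adjusted_use n \<psi> (f w))"
  unfolding adjusted_use_def by (intro continuous_intros)

lemma continuous_on_reduced_reward [continuous_intros]:
  "continuous_on A f \<Longrightarrow> continuous_on A g \<Longrightarrow> continuous_on A (\<lambda>w. reduced_reward n \<psi> (f w) (g w))"
  unfolding reduced_reward_def by (intro continuous_intros)

lemma continuous_on_pos_part [continuous_intros]:
  "continuous_on A f \<Longrightarrow> continuous_on A (\<lambda>w. pos_part (f w))"
  unfolding pos_part_def by (intro continuous_intros)

lemma continuous_on_price_update [continuous_intros]:
  "continuous_on A f \<Longrightarrow> continuous_on A g \<Longrightarrow> continuous_on A (\<lambda>w. price_update n \<psi> \<delta> (f w) (g w) y)"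
  unfolding price_update_def by (intro continuous_intros)

lemma continuous_on_objective [continuous_intros]:
  assumes "continuous_on A f" "continuous_on A g"
  shows "continuous_on A (\<lambda>w. objective n (f w) (g w))"
  unfolding objective_def
  by (intro continuous_intros assms[THEN continuous_on_product_then_coordinatewise])

lemma continuous_on_cone_lhs [continuous_intros]:
  assumes "continuous_on A f" "continuous_on A g"
  shows "continuous_on A (\<lambda>w. cone_lhs n \<psi> (f w) (g w))"
  unfolding cone_lhs_def
  by (intro continuous_intros assms[THEN continuous_on_product_then_coordinatewise])

text \<open>Upper semicontinuity: the superlevel sets are projections of closed sets along the compact
  set of all sequences in the subsimplex.\<close>
lemma closed_socp_value_ge:
  fixes b :: "real^'m::finite"
  assumes b: "\<And>j. 0 \<le> b $ j"
  shows "closed {\<xi> :: nat \<Rightarrow> ('m, 'k::finite) request. a \<le> socp_value n \<psi> b \<xi>}"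
proof -
  define K where "K = {x :: nat \<Rightarrow> real^'k. \<forall>t. x t \<in> subsimplex}"
  define T where "T = {(\<xi> :: nat \<Rightarrow> ('m, 'k) request, x).
    (\<forall>j. cone_lhs n \<psi> \<xi> x $ j \<le> b $ j) \<and> a \<le> objective n \<xi> x}"
  have K: "compact K" unfolding K_def by (intro compact_PiE_UNIV compact_subsimplex)
  have "closed T"
    unfolding T_def case_prod_beta
    by (intro closed_Collect_conj closed_Collect_all closed_Collect_le continuous_intros)
  hence "closed {\<xi>. \<exists>x\<in>K. (\<xi>, x) \<in> T}" by (rule closed_projection_compact[OF K])
  also have "{\<xi>. \<exists>x\<in>K. (\<xi>, x) \<in> T} = {\<xi>. a \<le> socp_value n \<psi> b \<xi>}"
  proof (intro set_eqI iffI; clarify)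
    fix \<xi> x assume "x \<in> K" "(\<xi>, x) \<in> T"
    hence "x \<in> socp_feasible n \<psi> b \<xi>" "a \<le> objective n \<xi> x"
      by (auto simp: socp_feasible_iff K_def T_def)
    thus "a \<le> socp_value n \<psi> b \<xi>" using objective_le_socp_value order_trans by blast
  next
    fix \<xi> :: "nat \<Rightarrow> ('m, 'k) request" assume a: "a \<le> socp_value n \<psi> b \<xi>"
    \<comment> \<open>The supremum must be attained to land in the projection of \<open>T\<close>;
      \<open>F\<close> is compact and nonempty and the objective is continuous on it.\<close>
    define F where "F = K \<inter> {x. \<forall>j. cone_lhs n \<psi> \<xi> x $ j \<le> b $ j}"
    have "closed {x. \<forall>j. cone_lhs n \<psi> \<xi> x $ j \<le> b $ j}"
      by (intro closed_Collect_all closed_Collect_le continuous_intros)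
    hence "compact F" unfolding F_def by (intro compact_Int_closed K)
    moreover have "(\<lambda>_. 0) \<in> F"
      using zero_feasible[of b n \<psi> \<xi>, OF b] by (simp add: F_def K_def socp_feasible_iff zero_in_subsimplex)
    moreover have "continuous_on F (objective n \<xi>)"
      by (intro continuous_intros)
    ultimately obtain x where x: "x \<in> F" "\<And>y. y \<in> F \<Longrightarrow> objective n \<xi> y \<le> objective n \<xi> x"
      using continuous_attains_sup[of F "objective n \<xi>"] by blast
    have "socp_value n \<psi> b \<xi> \<le> objective n \<xi> x"
    proof (intro socp_value_le b)
      fix y assume y: "y \<in> socp_feasible n \<psi> b \<xi>"
      \<comment> \<open>\<open>K\<close> restricts every entry, feasibility only the entries
        \<open>1..n\<close>. Zeroing the others changes neither the objective nor the
        constraints.\<close>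
      define y' where "y' t = (if t \<in> {1..n} then y t else 0)" for t
      have eq: "cone_lhs n \<psi> \<xi> y' = cone_lhs n \<psi> \<xi> y" "objective n \<xi> y' = objective n \<xi> y"
        by (auto simp: cone_lhs_def objective_def y'_def intro!: sum.cong)
      have "y' \<in> F"
        using y unfolding F_def K_def socp_feasible_iff
        by (auto simp: eq) (simp add: y'_def zero_in_subsimplex)
      from x(2)[OF this] show "objective n \<xi> y \<le> objective n \<xi> x" by (simp add: eq)
    qed
    thus "\<exists>x\<in>K. (\<xi>, x) \<in> T" using x(1) a by (intro bexI[of _ x]) (auto simp: F_def T_def)
  qed
  finally show ?thesis .
qed

lemma borel_measurable_socp_value:
  "(\<And>j. 0 \<le> b $ j) \<Longrightarrow> socp_value n \<psi> b \<in> borel_measurable borel"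
  unfolding borel_measurable_iff_ge by (auto intro!: borel_closed closed_socp_value_ge)

section \<open>Measurability of expectations over a run\<close>

text \<open>Replaces \<open>Max\<close> by comparisons of coordinates and the expectation by a
  finite sum, a form in which every ingredient is visibly measurable.\<close>

lemma expectation_decision:
  fixes g :: "real^'k::finite \<Rightarrow> real"
  shows "measure_pmf.expectation (decision n \<psi> tie z p) g =
    (if \<exists>l. 0 < reduced_reward n \<psi> z p $ l
     then \<Sum>l\<in>UNIV. pmf (tie {l. \<forall>i. reduced_reward n \<psi> z p $ i \<le> reduced_reward n \<psi> z p $ l}) l * g (axis l 1)
     else g 0)"
proof -
  define r where "r = reduced_reward n \<psi> z p"
  have pos: "0 < Max (range (\<lambda>l. r $ l)) \<longleftrightarrow> (\<exists>l. 0 < r $ l)"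
    by (subst Max_gr_iff) auto
  have eq: "Max (range (\<lambda>l. r $ l)) = r $ l \<longleftrightarrow> (\<forall>i. r $ i \<le> r $ l)" for l
    by (subst Max_eq_iff) auto
  show ?thesis
    unfolding decision_def Let_def r_def[symmetric] pos eq
    by (simp add: integral_measure_pmf_real[of UNIV] mult.commute)
qed

text \<open>Applied to the random set of maximizers: it takes finitely many values, so it may be
  composed with the arbitrary function \<open>tie\<close>.\<close>

lemma measurable_Collect_finite:
  fixes Q :: "'k::finite \<Rightarrow> 'w \<Rightarrow> bool"
  assumes "\<And>l. Measurable.pred N (Q l)"
  shows "(\<lambda>w. {l. Q l w}) \<in> N \<rightarrow>\<^sub>M count_space UNIV"
proof (subst measurable_count_space_eq_countable)
  show "(\<lambda>w. {l. Q l w}) \<in> space N \<rightarrow> UNIV \<and>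
    (\<forall>S\<in>UNIV. (\<lambda>w. {l. Q l w}) -` {S} \<inter> space N \<in> sets N)"
  proof (intro conjI ballI)
    fix S :: "'k set"
    have "(\<lambda>w. {l. Q l w}) -` {S} \<inter> space N = {w \<in> space N. \<forall>l. Q l w = (l \<in> S)}" by auto
    also have "\<dots> \<in> sets N" using assms by measurable
    finally show "(\<lambda>w. {l. Q l w}) -` {S} \<inter> space N \<in> sets N" .
  qed simp
qed simp

lemma borel_measurable_expectation_decision:
  fixes z :: "'w \<Rightarrow> ('m::finite, 'k::finite) request" and g :: "'w \<Rightarrow> real^'k \<Rightarrow> real"
  assumes z: "z \<in> borel_measurable N" and p: "p \<in> borel_measurable N"
    and g: "\<And>y. (\<lambda>w. g w y) \<in> borel_measurable N"
  shows "(\<lambda>w. measure_pmf.expectation (decision n \<psi> tie (z w) (p w)) (g w)) \<in> borel_measurable N"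
proof -
  have [measurable]: "(\<lambda>w. reduced_reward n \<psi> (z w) (p w) $ l) \<in> borel_measurable N" for l
    by (rule borel_measurable_continuous_Pair[OF z p, where H="\<lambda>z p. reduced_reward n \<psi> z p $ l"])
       (intro continuous_intros)
  have S: "(\<lambda>w. {l. \<forall>i. reduced_reward n \<psi> (z w) (p w) $ i \<le> reduced_reward n \<psi> (z w) (p w) $ l})
      \<in> N \<rightarrow>\<^sub>M count_space UNIV"
    by (rule measurable_Collect_finite) measurable
  have [measurable]: "(\<lambda>w. pmf (tie {l. \<forall>i. reduced_reward n \<psi> (z w) (p w) $ i \<le>
      reduced_reward n \<psi> (z w) (p w) $ l}) l) \<in> borel_measurable N" for l
    by (rule measurable_compose[OF S, of "\<lambda>A. pmf (tie A) l"]) simp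
  note g [measurable]
  show ?thesis unfolding expectation_decision by measurable
qed

text \<open>Induction over the rounds with \<open>h\<close> general: the last round is averaged out,
  which leaves another integrand \<open>h'\<close> that is jointly measurable in the parameter and
  the state.\<close>

lemma borel_measurable_expectation_run:
  fixes \<xi> :: "'w \<Rightarrow> nat \<Rightarrow> ('m::finite, 'k::finite) request"
    and h :: "'w \<Rightarrow> ('m, 'k) run_state \<Rightarrow> real"
  assumes \<xi>: "\<And>t. (\<lambda>w. \<xi> w t) \<in> borel_measurable N"
    and h: "(\<lambda>(w, a). h w a) \<in> borel_measurable (N \<Otimes>\<^sub>M borel)"
  shows "(\<lambda>w. measure_pmf.expectation (run n \<psi> \<delta> tie (\<xi> w) t) (h w)) \<in> borel_measurable N"
  using h
proof (induction t arbitrary: h)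
  case 0
  have "(\<lambda>w. case (w, (\<lambda>_. 0, 0)) of (w, a) \<Rightarrow> h w a) \<in> borel_measurable N"
    by (rule measurable_compose[OF _ 0]) simp
  thus ?case by simp
next
  case (Suc t)
  let ?N = "N \<Otimes>\<^sub>M (borel :: ('m, 'k) run_state measure)"
  define h' where "h' w a = measure_pmf.expectation (decision n \<psi> tie (\<xi> w (Suc t)) (snd a))
    (\<lambda>y. h w ((fst a)(Suc t := y), price_update n \<psi> \<delta> (\<xi> w (Suc t)) (snd a) y))" for w a
  have z: "(\<lambda>v. \<xi> (fst v) (Suc t)) \<in> borel_measurable ?N"
    by (rule measurable_compose[OF measurable_fst \<xi>])
  have a: "(\<lambda>v. fst (snd v)) \<in> borel_measurable ?N"
    by (rule measurable_compose[OF measurable_snd]) (intro borel_measurable_continuous_onI continuous_intros)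
  have p: "(\<lambda>v. snd (snd v)) \<in> borel_measurable ?N"
    by (rule measurable_compose[OF measurable_snd]) (intro borel_measurable_continuous_onI continuous_intros)
  have "(\<lambda>v. h' (fst v) (snd v)) \<in> borel_measurable ?N"
    unfolding h'_def
  proof (rule borel_measurable_expectation_decision[OF z p])
    fix y :: "real^'k"
    have "(\<lambda>v. (fst (snd v))(Suc t := y)) \<in> borel_measurable ?N"
    proof (rule measurable_coordinatewise_then_product)
      fix i show "(\<lambda>v. ((fst (snd v))(Suc t := y)) i) \<in> borel_measurable ?N"
        using measurable_product_then_coordinatewise[OF a, of i] by (cases "i = Suc t") auto
    qed
    moreover have "(\<lambda>v. price_update n \<psi> \<delta> (\<xi> (fst v) (Suc t)) (snd (snd v)) y) \<in> borel_measurable ?N"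
      by (rule borel_measurable_continuous_Pair[OF z p, where H="\<lambda>z p. price_update n \<psi> \<delta> z p y"])
         (intro continuous_intros)
    ultimately have "(\<lambda>v. (fst v, ((fst (snd v))(Suc t := y), price_update n \<psi> \<delta> (\<xi> (fst v) (Suc t)) (snd (snd v)) y)))
        \<in> ?N \<rightarrow>\<^sub>M ?N"
      by (intro measurable_Pair measurable_fst borel_measurable_Pair)
    from measurable_compose[OF this Suc.prems]
    show "(\<lambda>v. h (fst v) ((fst (snd v))(Suc t := y), price_update n \<psi> \<delta> (\<xi> (fst v) (Suc t)) (snd (snd v)) y))
        \<in> borel_measurable ?N"
      by simp
  qed
  hence "(\<lambda>(w, a). h' w a) \<in> borel_measurable ?N" by (simp add: case_prod_beta)
  from Suc.IH[OF this] show ?case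
    unfolding expectation_run_Suc h'_def by (simp add: case_prod_unfold)
qed

text \<open>Transfers Borel measurability on the space of all sequences to the product measure,
  whose elements are \<open>undefined\<close> and hence constant outside \<open>I\<close>.\<close>

lemma borel_measurable_PiM_ident:
  fixes P :: "'a::second_countable_topology measure" and I :: "'i::countable set"
  assumes "sets P = sets borel"
  shows "(\<lambda>\<xi>. \<xi>) \<in> borel_measurable (PiM I (\<lambda>_. P))"
proof (rule measurable_coordinatewise_then_product)
  fix i
  show "(\<lambda>\<xi>. \<xi> i) \<in> borel_measurable (PiM I (\<lambda>_. P))"
  proof (cases "i \<in> I")
    case True
    thus ?thesis using measurable_component_singleton[OF True, of "\<lambda>_. P"]
      by (simp cong: measurable_cong_sets add: assms)
  next
    case False
    hence "\<xi> i = undefined" if "\<xi> \<in> space (PiM I (\<lambda>_. P))" for \<xi>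
      using that by (auto simp: space_PiM PiE_def extensional_def)
    thus ?thesis by (subst measurable_cong[where g="\<lambda>_. undefined"]) auto
  qed
qed

section \<open>Expectations over the requests\<close>

text \<open>Used to change request \<open>t + 1\<close> without affecting the law of the price after
  \<open>t\<close> rounds.\<close>

lemma run_cong:
  assumes "\<And>s. s \<in> {1..t} \<Longrightarrow> \<xi> s = \<xi>' s"
  shows "run n \<psi> \<delta> tie \<xi> t = run n \<psi> \<delta> tie \<xi>' t"
  using assms by (induction t) (auto intro!: bind_pmf_cong)

lemma best_reward_attained:
  "\<exists>y\<in>choices. best_reward n \<psi> z p = reduced_reward n \<psi> z p \<bullet> y"
proof -
  let ?r = "reduced_reward n \<psi> z p"
  have "Max (range (\<lambda>l. ?r $ l)) \<in> range (\<lambda>l. ?r $ l)" by (rule Max_in) auto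
  then obtain l where "Max (range (\<lambda>l. ?r $ l)) = ?r $ l" by (rule rangeE)
  hence "Max (range (\<lambda>l. ?r $ l)) = ?r \<bullet> axis l 1" by (simp add: inner_axis)
  moreover have "best_reward n \<psi> z p \<in> {0, Max (range (\<lambda>l. ?r $ l))}"
    by (auto simp: best_reward_def max_def)
  ultimately consider "best_reward n \<psi> z p = ?r \<bullet> 0" | "best_reward n \<psi> z p = ?r \<bullet> axis l 1"
    by auto
  thus ?thesis by cases (unfold choices_def, blast+)
qed

lemma borel_measurable_dual_term:
  fixes z :: "'w \<Rightarrow> ('m::finite, 'k::finite) request"
  assumes z: "z \<in> borel_measurable N" and p: "p \<in> borel_measurable N"
  shows "(\<lambda>w. dual_term n \<psi> \<delta> (z w) (p w)) \<in> borel_measurable N"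
proof -
  have [measurable]: "(\<lambda>w. reduced_reward n \<psi> (z w) (p w) $ l) \<in> borel_measurable N" for l
    by (rule borel_measurable_continuous_Pair[OF z p, where H="\<lambda>z p. reduced_reward n \<psi> z p $ l"])
       (intro continuous_intros)
  note p [measurable]
  show ?thesis unfolding dual_term_def best_reward_def by measurable
qed

lemma abs_expectation_le:
  fixes f :: "'a \<Rightarrow> real"
  assumes "finite (set_pmf R)" "\<And>a. a \<in> set_pmf R \<Longrightarrow> \<bar>f a\<bar> \<le> c"
  shows "\<bar>measure_pmf.expectation R f\<bar> \<le> c"
proof -
  have "measure_pmf.expectation R f \<le> c"
    using assms(2) by (intro measure_pmf.integral_le_const integrable_measure_pmf_finite assms(1) AE_pmfI)
      (auto simp: abs_le_iff)
  moreover have "- c \<le> measure_pmf.expectation R f"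
    using assms(2) by (intro measure_pmf.integral_ge_const integrable_measure_pmf_finite assms(1) AE_pmfI)
      (force simp: abs_le_iff)
  ultimately show ?thesis by linarith
qed

text \<open>The maximum in the dual term is attained at one of the \<open>choices\<close>, where the
  bounds on a single step and a single reward apply.\<close>

lemma (in online_socp) abs_dual_term:
  assumes "admissible B z" shows "\<bar>dual_term n \<psi> \<delta> z p\<bar> \<le> B + norm p * M"
proof -
  obtain y where y: "y \<in> choices" "best_reward n \<psi> z p = reduced_reward n \<psi> z p \<bullet> y"
    using best_reward_attained by blast
  have "dual_term n \<psi> \<delta> z p = reward z \<bullet> y - p \<bullet> (adjusted_use n \<psi> z *v y - \<delta>)"
    by (simp add: dual_term_def y(2) reduced_reward_inner inner_diff_right)
  moreover have "\<bar>p \<bullet> (adjusted_use n \<psi> z *v y - \<delta>)\<bar> \<le> norm p * M"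
    using norm_step[OF assms y(1)]
    by (intro order_trans[OF Cauchy_Schwarz_ineq2] mult_left_mono) auto
  ultimately show ?thesis using reward_choices[OF assms y(1)] by linarith
qed

section \<open>Integrability and pointwise bounds under i.i.d. requests\<close>

locale online_socp_iid = online_socp n \<psi> \<delta> tie B dl du + prob_space P
  for n and \<psi> \<delta> :: "real^'m::finite" and tie :: "'k::finite set \<Rightarrow> 'k pmf" and B dl du
    and P :: "('m, 'k) request measure" +
  assumes sets_P: "sets P = sets borel"
    and admissible_AE: "AE z in P. admissible B z"
begin

text \<open>Provides Fubini's theorem for adding one coordinate to a finite index set.\<close>

sublocale PP: product_prob_space "\<lambda>_::nat. P" UNIV
  by unfold_locales

lemma AE_admissible: "finite I \<Longrightarrow> AE \<xi> in PiM I (\<lambda>_::nat. P). \<forall>s\<in>I. admissible B (\<xi> s)"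
  by (intro AE_finite_allI AE_PiM_component admissible_AE prob_space_axioms)

lemma prob_space_PiM: "prob_space (PiM I (\<lambda>_::nat. P))"
  by (intro prob_space_PiM prob_space_axioms)

lemma borel_measurable_PiM:
  "f \<in> borel_measurable borel \<Longrightarrow> f \<in> borel_measurable (PiM (I :: nat set) (\<lambda>_. P))"
  using measurable_compose[OF borel_measurable_PiM_ident[OF sets_P]] by fast

lemma integrable_PiM_bounded:
  fixes f :: "(nat \<Rightarrow> ('m, 'k) request) \<Rightarrow> real"
  assumes "f \<in> borel_measurable borel" "finite I"
    and "\<And>\<xi>. (\<And>s. s \<in> I \<Longrightarrow> admissible B (\<xi> s)) \<Longrightarrow> \<bar>f \<xi>\<bar> \<le> c"
  shows "integrable (PiM I (\<lambda>_. P)) f"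
proof -
  interpret Q: prob_space "PiM I (\<lambda>_. P)" by (rule prob_space_PiM)
  show ?thesis
  proof (rule Q.integrable_const_bound[of _ c])
    show "AE \<xi> in PiM I (\<lambda>_. P). norm (f \<xi>) \<le> c"
      using AE_admissible[OF assms(2)] by eventually_elim (auto intro: assms(3))
  qed (intro borel_measurable_PiM assms)
qed

lemma borel_measurable_run_objective:
  "(\<lambda>\<xi>. measure_pmf.expectation (algorithm_output n \<psi> \<delta> tie \<xi>) (objective n \<xi>)) \<in>
     borel_measurable borel"
  unfolding algorithm_output_def integral_map_pmf
proof (rule borel_measurable_expectation_run)
  show "(\<lambda>(\<xi>, a :: ('m, 'k) run_state). objective n \<xi> (fst a)) \<in> borel_measurable (borel \<Otimes>\<^sub>M borel)"
    unfolding borel_prod case_prod_beta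
    by (intro borel_measurable_continuous_onI continuous_intros)
qed (intro borel_measurable_continuous_onI continuous_on_product_coordinates)

lemma borel_measurable_mean_violation: "mean_violation n \<psi> \<delta> tie \<in> borel_measurable borel"
  unfolding mean_violation_def algorithm_output_def integral_map_pmf
proof (rule borel_measurable_expectation_run)
  show "(\<lambda>(\<xi>, a :: ('m, 'k) run_state). norm (pos_part (cone_lhs n \<psi> \<xi> (fst a) - real n *\<^sub>R \<delta>))) \<in>
      borel_measurable (borel \<Otimes>\<^sub>M borel)"
    unfolding borel_prod case_prod_beta
    by (intro borel_measurable_continuous_onI continuous_intros)
qed (intro borel_measurable_continuous_onI continuous_on_product_coordinates)

lemma borel_measurable_round_dual:
  "(\<lambda>w. round_dual (fst w) t (snd w)) \<in> borel_measurable borel"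
  unfolding round_dual_def
proof (rule borel_measurable_expectation_run)
  show "(\<lambda>(w :: (nat \<Rightarrow> ('m, 'k) request) \<times> ('m, 'k) request, a :: ('m, 'k) run_state).
      case a of (x, p) \<Rightarrow> dual_term n \<psi> \<delta> (snd w) p) \<in> borel_measurable (borel \<Otimes>\<^sub>M borel)"
    unfolding borel_prod case_prod_beta
    by (intro borel_measurable_dual_term borel_measurable_continuous_onI continuous_intros)
  show "(\<lambda>w :: (nat \<Rightarrow> ('m, 'k) request) \<times> ('m, 'k) request. fst w s) \<in> borel_measurable borel" for s
    by (rule borel_measurable_continuous_onI)
       (intro continuous_on_product_then_coordinatewise[OF continuous_on_fst] continuous_intros)
qed

lemma borel_measurable_round_dual_Suc:
  "(\<lambda>\<xi>. round_dual \<xi> t (\<xi> (Suc t))) \<in> borel_measurable borel"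
proof -
  have "(\<lambda>\<xi> :: nat \<Rightarrow> ('m, 'k) request. (\<xi>, \<xi> (Suc t))) \<in> borel_measurable borel"
    by (intro borel_measurable_continuous_onI continuous_intros continuous_on_product_coordinates)
  from measurable_compose[OF this borel_measurable_round_dual] show ?thesis by simp
qed

lemma measurable_P: "f \<in> borel_measurable borel \<Longrightarrow> f \<in> borel_measurable P"
  by (simp cong: measurable_cong_sets add: sets_P)

lemma mean_gap_eq:
  "mean_gap n \<psi> \<delta> tie \<xi> = socp_value n \<psi> (real n *\<^sub>R \<delta>) \<xi> -
     measure_pmf.expectation (algorithm_output n \<psi> \<delta> tie \<xi>) (objective n \<xi>)"
proof -
  have "integrable (measure_pmf (algorithm_output n \<psi> \<delta> tie \<xi>)) (objective n \<xi>)"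
    by (rule integrable_measure_pmf_finite) (simp add: algorithm_output_def finite_run)
  thus ?thesis by (simp add: mean_gap_def)
qed

lemma finite_algorithm_output: "finite (set_pmf (algorithm_output n \<psi> \<delta> tie \<xi>))"
  by (simp add: algorithm_output_def finite_run)

abbreviation "Q \<equiv> iid_requests P n"

lemma prob_space_Q: "prob_space Q"
  unfolding iid_requests_def by (rule prob_space_PiM)

lemma AE_Q: "AE \<xi> in Q. \<forall>s\<in>{1..n}. admissible B (\<xi> s)"
  unfolding iid_requests_def by (rule AE_admissible) simp

lemma integrable_socp_value: "integrable Q (socp_value n \<psi> (real n *\<^sub>R \<delta>))"
  unfolding iid_requests_def
proof (rule integrable_PiM_bounded[of _ _ "real n * B"])
  fix \<xi> :: "nat \<Rightarrow> ('m, 'k) request" assume "\<And>s. s \<in> {1..n} \<Longrightarrow> admissible B (\<xi> s)"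
  from socp_value_bounds[of \<xi>, OF this]
  show "\<bar>socp_value n \<psi> (real n *\<^sub>R \<delta>) \<xi>\<bar> \<le> real n * B" by simp
qed (auto intro!: borel_measurable_socp_value b_nonneg[simplified])

lemma integrable_run_objective:
  "integrable Q (\<lambda>\<xi>. measure_pmf.expectation (algorithm_output n \<psi> \<delta> tie \<xi>) (objective n \<xi>))"
  unfolding iid_requests_def
proof (rule integrable_PiM_bounded[of _ _ "real n * B"])
  fix \<xi> :: "nat \<Rightarrow> ('m, 'k) request" assume \<xi>: "\<And>s. s \<in> {1..n} \<Longrightarrow> admissible B (\<xi> s)"
  show "\<bar>measure_pmf.expectation (algorithm_output n \<psi> \<delta> tie \<xi>) (objective n \<xi>)\<bar> \<le> real n * B"
    using run_violation(2)[of \<xi>, OF \<xi>]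
    by (intro abs_expectation_le finite_algorithm_output objective_bounds \<xi>)
qed (auto intro: borel_measurable_run_objective)

lemma integrable_mean_gap: "integrable Q (mean_gap n \<psi> \<delta> tie)"
  unfolding mean_gap_eq
  by (intro Bochner_Integration.integrable_diff integrable_socp_value integrable_run_objective)

lemma abs_mean_violation:
  assumes \<xi>: "\<And>s. s \<in> {1..n} \<Longrightarrow> admissible B (\<xi> s)"
  shows "\<bar>mean_violation n \<psi> \<delta> tie \<xi>\<bar> \<le> V * sqrt (real n)"
  unfolding mean_violation_def using norm_violation[of \<xi>, OF \<xi>]
  by (intro abs_expectation_le finite_algorithm_output) simp

lemma integrable_mean_violation: "integrable Q (mean_violation n \<psi> \<delta> tie)"
  unfolding iid_requests_def
  by (rule integrable_PiM_bounded[OF borel_measurable_mean_violation _ abs_mean_violation]) auto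

lemma integral_mean_violation: "(\<integral>\<xi>. mean_violation n \<psi> \<delta> tie \<xi> \<partial>Q) \<le> V * sqrt (real n)"
proof (rule prob_space.integral_le_const[OF prob_space_Q integrable_mean_violation])
  show "AE \<xi> in Q. mean_violation n \<psi> \<delta> tie \<xi> \<le> V * sqrt (real n)"
    using AE_Q by eventually_elim (use abs_mean_violation in \<open>auto simp: abs_le_iff\<close>)
qed

lemma integral_mean_gap_ge: "- (B * V / dl) * sqrt (real n) \<le> (\<integral>\<xi>. mean_gap n \<psi> \<delta> tie \<xi> \<partial>Q)"
proof (rule prob_space.integral_ge_const[OF prob_space_Q integrable_mean_gap])
  show "AE \<xi> in Q. - (B * V / dl) * sqrt (real n) \<le> mean_gap n \<psi> \<delta> tie \<xi>"
    using AE_Q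
  proof eventually_elim
    case (elim \<xi>)
    have "measure_pmf.expectation (algorithm_output n \<psi> \<delta> tie \<xi>) (objective n \<xi>) \<le>
        socp_value n \<psi> (real n *\<^sub>R \<delta>) \<xi> + B * V / dl * sqrt (real n)"
      using elim by (intro measure_pmf.integral_le_const integrable_measure_pmf_finite
          finite_algorithm_output AE_pmfI objective_le_socp_value_plus) auto
    thus ?case by (simp add: mean_gap_eq)
  qed
qed

section \<open>The expected dual function and the upper bound of the gap\<close>

definition mean_dual :: "real^'m \<Rightarrow> real" where
  "mean_dual p = (\<integral>z. dual_term n \<psi> \<delta> z p \<partial>P)"

lemma borel_measurable_dual_term_P: "(\<lambda>z. dual_term n \<psi> \<delta> z p) \<in> borel_measurable P"
  by (intro borel_measurable_dual_term measurable_P) auto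

lemma integrable_dual_term: "integrable P (\<lambda>z. dual_term n \<psi> \<delta> z p)"
proof (rule integrable_const_bound[of _ "B + norm p * M"])
  show "AE z in P. norm (dual_term n \<psi> \<delta> z p) \<le> B + norm p * M"
    using admissible_AE by eventually_elim (simp add: abs_dual_term)
qed (rule borel_measurable_dual_term_P)

lemma abs_mean_dual: "\<bar>mean_dual p\<bar> \<le> B + norm p * M"
proof -
  have "AE z in P. \<bar>dual_term n \<psi> \<delta> z p\<bar> \<le> B + norm p * M"
    using admissible_AE by eventually_elim (rule abs_dual_term)
  hence "mean_dual p \<le> B + norm p * M" "- (B + norm p * M) \<le> mean_dual p"
    unfolding mean_dual_def
    by (auto intro!: integral_le_const integral_ge_const integrable_dual_term simp: abs_le_iff elim: eventually_mono)
  thus ?thesis by (simp add: abs_le_iff)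
qed

lemma borel_measurable_mean_dual: "mean_dual \<in> borel_measurable borel"
proof -
  have "(\<lambda>(p, z). dual_term n \<psi> \<delta> z p) \<in> borel_measurable (borel \<Otimes>\<^sub>M P)"
    unfolding case_prod_beta
    by (intro borel_measurable_dual_term measurable_compose[OF measurable_snd measurable_P] measurable_fst) simp
  from borel_measurable_lebesgue_integral[OF this] show ?thesis
    by (simp add: mean_dual_def[abs_def])
qed

text \<open>Integrates weak duality at a deterministic price. Every coordinate has law
  \<open>P\<close>, so the \<open>n\<close> dual terms have the same mean.\<close>

lemma mean_dual_ge:
  assumes "\<And>j. 0 \<le> p $ j" "norm p \<le> G"
  shows "(\<integral>\<xi>. socp_value n \<psi> (real n *\<^sub>R \<delta>) \<xi> \<partial>Q) - G * S * sqrt (real n) \<le> real n * mean_dual p"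
proof -
  have component: "distr Q P (\<lambda>\<xi>. \<xi> t) = P" if "t \<in> {1..n}" for t
    unfolding iid_requests_def using that by (intro distr_PiM_component prob_space_axioms)
  have comp_meas: "(\<lambda>\<xi>. \<xi> t) \<in> Q \<rightarrow>\<^sub>M P" if "t \<in> {1..n}" for t
    unfolding iid_requests_def using that by (rule measurable_component_singleton)
  have int: "integrable Q (\<lambda>\<xi>. dual_term n \<psi> \<delta> (\<xi> t) p)"
    and eq: "(\<integral>\<xi>. dual_term n \<psi> \<delta> (\<xi> t) p \<partial>Q) = mean_dual p" if "t \<in> {1..n}" for t
  proof -
    show "integrable Q (\<lambda>\<xi>. dual_term n \<psi> \<delta> (\<xi> t) p)"
      using integrable_distr[OF comp_meas[OF that], of "\<lambda>z. dual_term n \<psi> \<delta> z p"]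
        component[OF that] integrable_dual_term by simp
    show "(\<integral>\<xi>. dual_term n \<psi> \<delta> (\<xi> t) p \<partial>Q) = mean_dual p"
      using integral_distr[OF comp_meas[OF that] borel_measurable_dual_term_P, of p]
        component[OF that] by (simp add: mean_dual_def)
  qed
  have "(\<integral>\<xi>. socp_value n \<psi> (real n *\<^sub>R \<delta>) \<xi> \<partial>Q) \<le>
      (\<integral>\<xi>. (\<Sum>t=1..n. dual_term n \<psi> \<delta> (\<xi> t) p) + norm p * S * sqrt (real n) \<partial>Q)"
  proof (rule integral_mono_AE)
    interpret Q: prob_space Q by (rule prob_space_Q)
    show "integrable Q (\<lambda>\<xi>. (\<Sum>t=1..n. dual_term n \<psi> \<delta> (\<xi> t) p) + norm p * S * sqrt (real n))"
      by (intro Bochner_Integration.integrable_add Bochner_Integration.integrable_sum int) auto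
    show "AE \<xi> in Q. socp_value n \<psi> (real n *\<^sub>R \<delta>) \<xi> \<le>
        (\<Sum>t=1..n. dual_term n \<psi> \<delta> (\<xi> t) p) + norm p * S * sqrt (real n)"
      using AE_Q by eventually_elim (rule socp_value_le_dual; use assms(1) in blast)
  qed (rule integrable_socp_value)
  also have "\<dots> = real n * mean_dual p + norm p * S * sqrt (real n)"
  proof -
    interpret Q: prob_space Q by (rule prob_space_Q)
    have "(\<integral>\<xi>. (\<Sum>t=1..n. dual_term n \<psi> \<delta> (\<xi> t) p) + norm p * S * sqrt (real n) \<partial>Q) =
      (\<Sum>t=1..n. \<integral>\<xi>. dual_term n \<psi> \<delta> (\<xi> t) p \<partial>Q) + norm p * S * sqrt (real n)"
      using int by (subst Bochner_Integration.integral_add)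
        (auto simp: Q.prob_space intro!: Bochner_Integration.integrable_sum Bochner_Integration.integral_sum)
    thus ?thesis using eq by simp
  qed
  also have "norm p * S * sqrt (real n) \<le> G * S * sqrt (real n)"
    using assms(2) S_nonneg by (intro mult_right_mono) auto
  finally show ?thesis by simp
qed

text \<open>The price after \<open>t\<close> rounds does not depend on request \<open>t + 1\<close>, which can therefore be
  integrated out first.\<close>
lemma integral_round_dual_ge:
  assumes t: "t < n"
  shows "(\<integral>\<xi>. socp_value n \<psi> (real n *\<^sub>R \<delta>) \<xi> \<partial>Q) - G * S * sqrt (real n) \<le>
      real n * (\<integral>\<xi>. round_dual \<xi> t (\<xi> (Suc t)) \<partial>Q)"
    and "integrable Q (\<lambda>\<xi>. round_dual \<xi> t (\<xi> (Suc t)))"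
proof -
  define L where "L = (\<integral>\<xi>. socp_value n \<psi> (real n *\<^sub>R \<delta>) \<xi> \<partial>Q) - G * S * sqrt (real n)"
  define I where "I = {1..n} - {Suc t}"
  have I: "insert (Suc t) I = {1..n}" "finite I" "Suc t \<notin> I" "{1..t} \<subseteq> I"
    using t by (auto simp: I_def)
  interpret QI: prob_space "PiM I (\<lambda>_. P)" by (rule prob_space_PiM)
  \<comment> \<open>Serves both \<open>dual_term\<close> at a fixed request and
    \<open>mean_dual\<close>: each grows at most linearly in the price, and prices of the run have
    norm at most \<open>G\<close>.\<close>
  have bound: "\<bar>measure_pmf.expectation (run n \<psi> \<delta> tie \<xi> t) (\<lambda>(x, p). f p)\<bar> \<le> B + G * M"
    if \<xi>: "\<And>s. s \<in> {1..t} \<Longrightarrow> admissible B (\<xi> s)"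
      and f: "\<And>p. \<bar>f p\<bar> \<le> B + norm p * M" for f :: "real^'m \<Rightarrow> real" and \<xi>
  proof (intro abs_expectation_le finite_run)
    fix a assume "a \<in> set_pmf (run n \<psi> \<delta> tie \<xi> t)"
    moreover obtain x p where a: "a = (x, p)" by fastforce
    ultimately have "norm p \<le> G" using run_invariant[of t \<xi> x p, OF \<xi>] by auto
    hence "norm p * M \<le> G * M" using M_nonneg by (rule mult_right_mono)
    thus "\<bar>case a of (x, p) \<Rightarrow> f p\<bar> \<le> B + G * M" using f[of p] by (simp add: a)
  qed
  show int: "integrable Q (\<lambda>\<xi>. round_dual \<xi> t (\<xi> (Suc t)))"
    unfolding iid_requests_def
  proof (rule integrable_PiM_bounded[OF borel_measurable_round_dual_Suc])
    fix \<xi> :: "nat \<Rightarrow> ('m, 'k) request" assume \<xi>: "\<And>s. s \<in> {1..n} \<Longrightarrow> admissible B (\<xi> s)"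
    show "\<bar>round_dual \<xi> t (\<xi> (Suc t))\<bar> \<le> B + G * M"
      unfolding round_dual_def using t by (intro bound \<xi> abs_dual_term) auto
  qed simp
  define f where "f \<xi> = measure_pmf.expectation (run n \<psi> \<delta> tie \<xi> t) (\<lambda>(x, p). mean_dual p)" for \<xi>
  have "(\<integral>\<xi>. round_dual \<xi> t (\<xi> (Suc t)) \<partial>Q) =
      (\<integral>\<xi>. (\<integral>z. round_dual (\<xi>(Suc t := z)) t ((\<xi>(Suc t := z)) (Suc t)) \<partial>P) \<partial>PiM I (\<lambda>_. P))"
    using PP.product_integral_insert[OF I(2,3), of "\<lambda>\<xi>. round_dual \<xi> t (\<xi> (Suc t))"] int
    unfolding I(1) iid_requests_def by simp
  also have "\<dots> = (\<integral>\<xi>. f \<xi> \<partial>PiM I (\<lambda>_. P))"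
  proof (rule Bochner_Integration.integral_cong[OF refl])
    fix \<xi> :: "nat \<Rightarrow> ('m, 'k) request"
    \<comment> \<open>The law of the run is the same for all \<open>z\<close>, so the integral over
      \<open>z\<close> passes through a finite sum and meets the dual term at each possible price
      separately.\<close>
    have "run n \<psi> \<delta> tie (\<xi>(Suc t := z)) t = run n \<psi> \<delta> tie \<xi> t" for z
      by (rule run_cong) auto
    hence "(\<integral>z. round_dual (\<xi>(Suc t := z)) t ((\<xi>(Suc t := z)) (Suc t)) \<partial>P) =
        (\<integral>z. (\<Sum>a\<in>set_pmf (run n \<psi> \<delta> tie \<xi> t). pmf (run n \<psi> \<delta> tie \<xi> t) a * dual_term n \<psi> \<delta> z (snd a)) \<partial>P)"
      by (simp add: round_dual_def integral_measure_pmf[OF finite_run] case_prod_beta)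
    also have "\<dots> = (\<Sum>a\<in>set_pmf (run n \<psi> \<delta> tie \<xi> t). pmf (run n \<psi> \<delta> tie \<xi> t) a * mean_dual (snd a))"
      by (subst Bochner_Integration.integral_sum) (auto simp: mean_dual_def integrable_dual_term)
    finally show "(\<integral>z. round_dual (\<xi>(Suc t := z)) t ((\<xi>(Suc t := z)) (Suc t)) \<partial>P) = f \<xi>"
      by (simp add: f_def integral_measure_pmf[OF finite_run] case_prod_beta)
  qed
  \<comment> \<open>Almost surely every price in the support is nonnegative with norm at most
    \<open>G\<close>, so \<open>mean_dual_ge\<close> applies to each of them with the same
    bound.\<close>
  also have "L / real n \<le> \<dots>"
  proof (rule QI.integral_ge_const)
    have "f \<in> borel_measurable borel"
      unfolding f_def
    proof (rule borel_measurable_expectation_run)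
      show "(\<lambda>(w :: nat \<Rightarrow> ('m, 'k) request, a :: ('m, 'k) run_state).
          case a of (x, p) \<Rightarrow> mean_dual p) \<in> borel_measurable (borel \<Otimes>\<^sub>M borel)"
        unfolding borel_prod case_prod_beta
        by (rule measurable_compose[OF _ borel_measurable_mean_dual])
           (intro borel_measurable_continuous_onI continuous_intros)
    qed (intro borel_measurable_continuous_onI continuous_on_product_coordinates)
    moreover have "\<bar>f \<xi>\<bar> \<le> B + G * M" if "\<And>s. s \<in> I \<Longrightarrow> admissible B (\<xi> s)" for \<xi>
      unfolding f_def using I(4) that by (intro bound abs_mean_dual) blast
    ultimately show "integrable (PiM I (\<lambda>_. P)) f"
      using integrable_PiM_bounded[OF _ I(2)] by blast
    show "AE \<xi> in PiM I (\<lambda>_. P). L / real n \<le> f \<xi>"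
      using AE_admissible[OF I(2)]
    proof eventually_elim
      case (elim \<xi>)
      show ?case unfolding f_def
      proof (intro measure_pmf.integral_ge_const integrable_run AE_pmfI)
        fix a assume "a \<in> set_pmf (run n \<psi> \<delta> tie \<xi> t)"
        moreover obtain x p where a: "a = (x, p)" by fastforce
        ultimately have "(\<forall>j. 0 \<le> p $ j) \<and> norm p \<le> G"
          using run_invariant[of t \<xi> x p] elim I(4) by blast
        hence "L \<le> real n * mean_dual p" unfolding L_def by (intro mean_dual_ge) auto
        thus "L / real n \<le> (case a of (x, p) \<Rightarrow> mean_dual p)"
          using sqrt_n(2) by (simp add: a divide_le_eq mult.commute)
      qed
    qed
  qed
  finally have "L \<le> real n * (\<integral>\<xi>. round_dual \<xi> t (\<xi> (Suc t)) \<partial>Q)"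
    using sqrt_n(2) by (simp add: divide_le_eq mult.commute)
  thus "(\<integral>\<xi>. socp_value n \<psi> (real n *\<^sub>R \<delta>) \<xi> \<partial>Q) - G * S * sqrt (real n) \<le>
      real n * (\<integral>\<xi>. round_dual \<xi> t (\<xi> (Suc t)) \<partial>Q)"
    unfolding L_def .
qed

text \<open>Each of the \<open>n\<close> rounds has an expected dual term of at least the n-th part
  of the expected optimum minus \<open>G * S * sqrt n\<close>; their sum is at most the expected
  reward plus \<open>M^2 / 2 * sqrt n\<close>.\<close>

lemma integral_mean_gap_le:
  "(\<integral>\<xi>. mean_gap n \<psi> \<delta> tie \<xi> \<partial>Q) \<le> (G * S + M\<^sup>2 / 2) * sqrt (real n)"
proof -
  interpret Q: prob_space Q by (rule prob_space_Q)
  let ?R = "\<integral>\<xi>. socp_value n \<psi> (real n *\<^sub>R \<delta>) \<xi> \<partial>Q"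
  let ?A = "\<lambda>\<xi>. measure_pmf.expectation (algorithm_output n \<psi> \<delta> tie \<xi>) (objective n \<xi>)"
  let ?D = "\<lambda>t. \<integral>\<xi>. round_dual \<xi> t (\<xi> (Suc t)) \<partial>Q"
  have int: "integrable Q (\<lambda>\<xi>. \<Sum>t<n. round_dual \<xi> t (\<xi> (Suc t)))"
    by (intro Bochner_Integration.integrable_sum integral_round_dual_ge) simp
  have "(\<Sum>t<n. (?R - G * S * sqrt (real n)) / real n) \<le> (\<Sum>t<n. ?D t)"
    using integral_round_dual_ge(1) sqrt_n(2)
    by (intro sum_mono) (simp add: divide_le_eq mult.commute)
  hence "?R - G * S * sqrt (real n) - M\<^sup>2 / 2 * sqrt (real n) \<le> (\<Sum>t<n. ?D t) - M\<^sup>2 / 2 * sqrt (real n)"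
    using sqrt_n(2) by simp
  also have "\<dots> = (\<integral>\<xi>. (\<Sum>t<n. round_dual \<xi> t (\<xi> (Suc t))) - M\<^sup>2 / 2 * sqrt (real n) \<partial>Q)"
    using int integral_round_dual_ge(2)
    by (subst Bochner_Integration.integral_diff)
       (auto simp: Q.prob_space intro!: Bochner_Integration.integral_sum[symmetric])
  also have "\<dots> \<le> (\<integral>\<xi>. ?A \<xi> \<partial>Q)"
  proof (rule integral_mono_AE)
    show "AE \<xi> in Q. (\<Sum>t<n. round_dual \<xi> t (\<xi> (Suc t))) - M\<^sup>2 / 2 * sqrt (real n) \<le> ?A \<xi>"
      using AE_Q by eventually_elim (rule sum_round_dual_le, blast)
  qed (use int integrable_run_objective in auto)
  finally have "?R - (\<integral>\<xi>. ?A \<xi> \<partial>Q) \<le> (G * S + M\<^sup>2 / 2) * sqrt (real n)"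
    by (simp add: distrib_right)
  thus ?thesis
    unfolding mean_gap_eq
    by (subst Bochner_Integration.integral_diff[OF integrable_socp_value integrable_run_objective])
qed

end

section \<open>A constant uniform in the horizon\<close>

theorem theorem3:
  fixes P :: "('m::finite, 'k::finite) request measure"
    and \<psi> :: "real^'m"
    and d :: "nat \<Rightarrow> real^'m"
    and tie :: "'k set \<Rightarrow> 'k pmf"
    and B d_lower d_upper :: real
  assumes "prob_space P"
    and "sets P = sets borel"
    and "AE z in P. \<forall>j. covariance_matrix (cov_use z $ j)"
    and "AE z in P. bounded_request B z"
    and "\<And>j. 0 < \<psi> $ j"
    and "0 < d_lower"
    and "\<And>n j. d_lower \<le> d n $ j \<and> d n $ j \<le> d_upper"
    and "tie_breaking tie"
  shows "\<exists>C\<ge>0. \<forall>n\<ge>1.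
           integrable (iid_requests P n) (mean_gap n \<psi> (d n) tie) \<and>
           integrable (iid_requests P n) (mean_violation n \<psi> (d n) tie) \<and>
           - C * sqrt (real n) \<le> (\<integral>\<xi>. mean_gap n \<psi> (d n) tie \<xi> \<partial>iid_requests P n) \<and>
           (\<integral>\<xi>. mean_gap n \<psi> (d n) tie \<xi> \<partial>iid_requests P n) \<le> C * sqrt (real n) \<and>
           (\<integral>\<xi>. mean_violation n \<psi> (d n) tie \<xi> \<partial>iid_requests P n) \<le> C * sqrt (real n)"
proof -
  interpret P: prob_space P by fact
  have AE: "AE z in P. admissible B z"
    using assms(3,4) by eventually_elim (simp add: admissible_def)
  \<comment> \<open>In a probability space a condition free of \<open>z\<close> that holds almost
    surely holds outright.\<close>
  hence "AE z in P. 0 \<le> B" by eventually_elim (rule admissible_nonneg)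
  hence B: "0 \<le> B" by simp
  \<comment> \<open>\<open>C1\<close> controls the violation, \<open>C2\<close> the gap from below
    and \<open>C3\<close> the gap from above. They depend on the bounds \<open>d_lower\<close> and
    \<open>d_upper\<close> but not on \<open>d n\<close>, so they are chosen before
    \<open>n\<close>.\<close>
  define C1 where "C1 = violation_bound B \<psi> d_lower d_upper"
  define C2 where "C2 = B * C1 / d_lower"
  define C3 where "C3 = price_bound B \<psi> d_lower d_upper * psi_weight B \<psi> + (step_bound B \<psi> d_upper)\<^sup>2 / 2"
  define C where "C = max 0 (max C1 (max C2 C3))"
  have le: "C1 * sqrt (real n) \<le> C * sqrt (real n)" "C2 * sqrt (real n) \<le> C * sqrt (real n)"
    "C3 * sqrt (real n) \<le> C * sqrt (real n)" for n
    by (intro mult_right_mono; simp add: C_def)+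
  show ?thesis
  proof (intro exI[of _ C] conjI allI impI)
    show "0 \<le> C" by (simp add: C_def)
  next
    fix n :: nat assume n: "1 \<le> n"
    interpret online_socp_iid n \<psi> "d n" tie B d_lower d_upper P
      using n B AE assms by unfold_locales auto
    show "integrable (iid_requests P n) (mean_gap n \<psi> (d n) tie)"
      by (rule integrable_mean_gap)
    show "integrable (iid_requests P n) (mean_violation n \<psi> (d n) tie)"
      by (rule integrable_mean_violation)
    show "- C * sqrt (real n) \<le> (\<integral>\<xi>. mean_gap n \<psi> (d n) tie \<xi> \<partial>iid_requests P n)"
      using integral_mean_gap_ge le(2)[of n] by (simp add: C1_def C2_def)
    show "(\<integral>\<xi>. mean_gap n \<psi> (d n) tie \<xi> \<partial>iid_requests P n) \<le> C * sqrt (real n)"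
      using integral_mean_gap_le le(3)[of n] by (simp add: C3_def)
    show "(\<integral>\<xi>. mean_violation n \<psi> (d n) tie \<xi> \<partial>iid_requests P n) \<le> C * sqrt (real n)"
      using integral_mean_violation le(1)[of n] by (simp add: C1_def)
  qed
qed

end
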